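(* Every twisted spreading model of $Z(\mathcal T^2)$ is isomorphic to $\ell_2$.
   Context: $\omega$ is the space of all complex sequences with pointwise convergence; $c_{00}$ is the space of finitely supported sequences. Consecutive blocks are finitely supported vectors $u_1,u_2,\dots$ with $\max\operatorname{supp}u_j<\min\operatorname{supp}u_{j+1}$. Tsirelson's space. For $x\in c_{00}$ let $\|x\|_0=\max_j|x_j|$ and $\|x\|_{n+1}=\max\{\|x\|_n,\frac12\max\sum_{j=1}^k\|A_jx\|_n\}$, where the inner maximum is over all $k$ and finite subsets $k\le A_1<\dots<A_k$ of $\mathbb N$ ($A_j<A_{j+1}$ means $\max A_j<\min A_{j+1}$; $A_jx$ is the restriction of $x$ to $A_j$). $\mathcal T$ is the completion of $c_{00}$ under $\|x\|=\lim_n\|x\|_n$. $\mathcal T^2$ (2-convexification) is the completion of $c_{00}$ under $\|x\|_{\mathcal T^2}=\|\,|x|^2\,\|_{\mathcal T}^{1/2}$. The space $Z(X)$, here with $X=\mathcal T^2$. Let $X$ be a space with a 1-unconditional basis $(e_j)$, regarded as a sequence space in $\omega$ through the basis, with $X^*$ regarded as a sequence space through $x^*\mapsto(x^*(e_j))_j$. Let $\mathbb S=\{z\in\mathbb C:0\le \operatorname{Re}z\le 1\}$. $\mathcal F_\infty(X,X^* )$ is the space of functions $F:\mathbb S\to\omega$, bounded and continuous on $\mathbb S$, analytic in its interior, such that $t\mapsto F(it)\in X$ and $t\mapsto F(1+it)\in X^*$ are bounded and continuous, with norm $\max(\sup_t\|F(it)\|_X,\sup_t\|F(1+it)\|_{X^*})$.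 The interpolation space $(X,X^* )_{1/2}=\{F(1/2):F\in\mathcal F_\infty(X,X^* )\}$ with the quotient norm equals $\ell_2$ up to an equivalent norm. Fix a homogeneous selection $x\in\ell_2\mapsto B(x)\in\mathcal F_\infty(X,X^* )$ with $B(x)(1/2)=x$ and $\|B(x)\|\le C\|x\|_2$, and put $\Omega(x)=B(x)'(1/2)\in\omega$. Then $Z(X)=\{(x,y)\in\omega\times\omega: y\in\ell_2,\ x-\Omega(y)\in\ell_2\}$ with the quasi-norm $\|(x,y)\|=\|x-\Omega(y)\|_2+\|y\|_2$ (which is equivalent to a norm). The selection used on finitely supported $u$ with $\|u\|_2=1$ is the following: write $|u|^2=|v|\,|w|$ with $\|v\|_X,\|w\|_{X^*}\le1$ and $\operatorname{supp}u=\operatorname{supp}v=\operatorname{supp}w$ (Lozanovskii factorization) and take $B(u)(z)=u|v|^{1/2-z}|w|^{z-1/2}$ coordinatewise on $\operatorname{supp}u$, extended homogeneously. Twisted spreading model of $Z(X)$ (with centralizer $\Omega$): let $(u_j)$ be a sequence of normalized consecutive blocks in $\ell_2$ such that (after passing to a subsequence; this is always possible) for every $n$ and all scalars $a_1,\dots,a_n,b_1,\dots,b_n$ the limit $$\lim_{\nu\to\infty,\ \nu<k_1<\dots<k_n}\Big(\Big\|\sum_{j=1}^n a_ju_{k_j}+\sum_{j=1}^n b_j\Omega(u_{k_j})-\Omega\Big(\sum_{j=1}^n b_ju_{k_j}\Big)\Big\|_2+\Big\|\sum_{j=1}^n b_ju_{k_j}\Big\|_2\Big)$$ exists. The completion of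 $c_{00}\times c_{00}$ under the quasi-norm $\|(a,b)\|$ given by this limit is a twisted spreading model of $Z(X)$. *)

theory Defs
  imports "HOL-Complex_Analysis.Complex_Analysis"
begin

text \<open>
  The space \<open>\<omega>\<close> is the type \<open>nat \<Rightarrow> complex\<close> with its product topology. Coordinates are counted
  from 0, so that the index \<open>i\<close> stands for the position \<open>i + 1\<close> in \<open>{1, 2, \<dots>}\<close>; this matters only
  in the admissibility condition of the Tsirelson norm.
\<close>

definition supp :: "(nat \<Rightarrow> complex) \<Rightarrow> nat set" where
  "supp x = {j. x j \<noteq> 0}"

definition c00 :: "(nat \<Rightarrow> complex) set" where
  "c00 = {x. finite (supp x)}"

definition restr :: "nat set \<Rightarrow> (nat \<Rightarrow> complex) \<Rightarrow> nat \<Rightarrow> complex" where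
  "restr A x = (\<lambda>j. if j \<in> A then x j else 0)"

definition ell2 :: "(nat \<Rightarrow> complex) set" where
  "ell2 = {x. summable (\<lambda>j. (cmod (x j))\<^sup>2)}"

definition l2_norm :: "(nat \<Rightarrow> complex) \<Rightarrow> real" where
  "l2_norm x = sqrt (\<Sum>j. (cmod (x j))\<^sup>2)"


subsection \<open>Tsirelson's space and its 2-convexification\<close>

text \<open>
  \<open>admissible k A\<close> says \<open>k \<le> A\<^sub>1 < \<dots> < A\<^sub>k\<close>, where \<open>A\<^sub>1, \<dots>, A\<^sub>k\<close> are \<open>A 0, \<dots>, A (k - 1)\<close>. The
  \<open>Suc\<close> in the third line translates the index into the position.
\<close>

definition admissible :: "nat \<Rightarrow> (nat \<Rightarrow> nat set) \<Rightarrow> bool" where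
  "admissible k A \<longleftrightarrow> 1 \<le> k \<and>
     (\<forall>j<k. finite (A j) \<and> A j \<noteq> {}) \<and>
     k \<le> Suc (Min (A 0)) \<and>
     (\<forall>j. Suc j < k \<longrightarrow> Max (A j) < Min (A (Suc j)))"

text \<open>
  These are norms on \<open>c00\<close>, where the suprema are over finite sets of values, hence maxima.
\<close>

fun tsirelson_iter :: "nat \<Rightarrow> (nat \<Rightarrow> complex) \<Rightarrow> real" where
  "tsirelson_iter 0 x = (SUP j. cmod (x j))"
| "tsirelson_iter (Suc n) x =
     max (tsirelson_iter n x)
         (1/2 * (SUP (k, A) \<in> {(k, A). admissible k A}. \<Sum>j<k. tsirelson_iter n (restr (A j) x)))"

definition tsirelson_norm :: "(nat \<Rightarrow> complex) \<Rightarrow> real" where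
  "tsirelson_norm x = lim (\<lambda>n. tsirelson_iter n x)"

definition T2_norm :: "(nat \<Rightarrow> complex) \<Rightarrow> real" where
  "T2_norm x = sqrt (tsirelson_norm (\<lambda>j. of_real ((cmod (x j))\<^sup>2)))"


subsection \<open>A space with a basis and its dual as sequence spaces\<close>

text \<open>
  Below, \<open>N\<close> is a norm on \<open>c00\<close> for which the unit vectors are 1-unconditional, and \<open>X\<close> is the
  completion of \<open>c00\<close> under \<open>N\<close>. A sequence belongs to \<open>X\<close> iff its basis expansion converges in
  \<open>X\<close>, that is, iff its partial sums form an \<open>N\<close>-Cauchy sequence.
\<close>

definition X_space :: "((nat \<Rightarrow> complex) \<Rightarrow> real) \<Rightarrow> (nat \<Rightarrow> complex) set" where
  "X_space N = {x. \<forall>e>0. \<exists>M. \<forall>m\<ge>M. \<forall>n\<ge>M.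
     N (\<lambda>j. restr {..<m} x j - restr {..<n} x j) < e}"

definition X_norm :: "((nat \<Rightarrow> complex) \<Rightarrow> real) \<Rightarrow> (nat \<Rightarrow> complex) \<Rightarrow> real" where
  "X_norm N x = lim (\<lambda>n. N (restr {..<n} x))"

text \<open>
  As \<open>c00\<close> is dense in \<open>X\<close>, the sequence \<open>y\<close> comes from a functional on \<open>X\<close> iff
  \<open>x \<mapsto> \<Sum>j. x j * y j\<close> is bounded on the unit ball of \<open>c00\<close>, and the norm is the supremum there.
\<close>

definition dual_values :: "((nat \<Rightarrow> complex) \<Rightarrow> real) \<Rightarrow> (nat \<Rightarrow> complex) \<Rightarrow> real set" where
  "dual_values N y = {cmod (\<Sum>j\<in>supp x. x j * y j) |x. x \<in> c00 \<and> N x \<le> 1}"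

definition dual_space :: "((nat \<Rightarrow> complex) \<Rightarrow> real) \<Rightarrow> (nat \<Rightarrow> complex) set" where
  "dual_space N = {y. bdd_above (dual_values N y)}"

definition dual_norm :: "((nat \<Rightarrow> complex) \<Rightarrow> real) \<Rightarrow> (nat \<Rightarrow> complex) \<Rightarrow> real" where
  "dual_norm N y = Sup (dual_values N y)"


subsection \<open>Complex interpolation and the centralizer\<close>

definition strip :: "complex set" where
  "strip = {z. 0 \<le> Re z \<and> Re z \<le> 1}"

definition bdd_cont_curve ::
    "(nat \<Rightarrow> complex) set \<Rightarrow> ((nat \<Rightarrow> complex) \<Rightarrow> real) \<Rightarrow> (real \<Rightarrow> nat \<Rightarrow> complex) \<Rightarrow> bool" where
  "bdd_cont_curve V nrm f \<longleftrightarrow>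
     (\<forall>t. f t \<in> V) \<and>
     bounded (range (\<lambda>t. nrm (f t))) \<and>
     (\<forall>t. ((\<lambda>s. nrm (\<lambda>j. f s j - f t j)) \<longlongrightarrow> 0) (at t))"

text \<open>
  Boundedness and analyticity of an \<open>\<omega>\<close>-valued function are coordinatewise notions; \<open>bounded\<close> for
  the metric of the type \<open>nat \<Rightarrow> complex\<close> would be void.
\<close>

definition F_infty :: "((nat \<Rightarrow> complex) \<Rightarrow> real) \<Rightarrow> (complex \<Rightarrow> nat \<Rightarrow> complex) set" where
  "F_infty N = {F.
     continuous_on strip F \<and>
     (\<forall>j. bounded ((\<lambda>z. F z j) ` strip)) \<and>
     (\<forall>j. (\<lambda>z. F z j) holomorphic_on interior strip) \<and>
     bdd_cont_curve (X_space N) (X_norm N) (\<lambda>t. F (\<i> * of_real t)) \<and>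
     bdd_cont_curve (dual_space N) (dual_norm N) (\<lambda>t. F (1 + \<i> * of_real t))}"

definition F_norm :: "((nat \<Rightarrow> complex) \<Rightarrow> real) \<Rightarrow> (complex \<Rightarrow> nat \<Rightarrow> complex) \<Rightarrow> real" where
  "F_norm N F = max (SUP t::real. X_norm N (F (\<i> * of_real t)))
                    (SUP t::real. dual_norm N (F (1 + \<i> * of_real t)))"

definition homogeneous_selection ::
    "((nat \<Rightarrow> complex) \<Rightarrow> real) \<Rightarrow> ((nat \<Rightarrow> complex) \<Rightarrow> complex \<Rightarrow> nat \<Rightarrow> complex) \<Rightarrow> bool" where
  "homogeneous_selection N B \<longleftrightarrow>
     (\<forall>x\<in>ell2. B x \<in> F_infty N \<and> B x (1/2) = x) \<and>
     (\<forall>x\<in>ell2. \<forall>c. \<forall>z\<in>strip. \<forall>j. B (\<lambda>i. c * x i) z j = c * B x z j) \<and>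
     (\<exists>C. \<forall>x\<in>ell2. F_norm N (B x) \<le> C * l2_norm x)"

definition lozanovskii_factorization ::
    "((nat \<Rightarrow> complex) \<Rightarrow> real) \<Rightarrow> (nat \<Rightarrow> complex) \<Rightarrow> (nat \<Rightarrow> complex) \<Rightarrow> (nat \<Rightarrow> complex) \<Rightarrow> bool" where
  "lozanovskii_factorization N u v w \<longleftrightarrow>
     (\<forall>j. (cmod (u j))\<^sup>2 = cmod (v j) * cmod (w j)) \<and>
     X_norm N v \<le> 1 \<and> dual_norm N w \<le> 1 \<and>
     supp v = supp u \<and> supp w = supp u"

text \<open>
  Off the support of \<open>u\<close> the factor \<open>u j\<close> makes the prescribed value 0. By homogeneity the
  condition determines \<open>B\<close> on all of \<open>c00\<close>: the moduli of \<open>v\<close> and \<open>w\<close> are unique.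
\<close>

definition lozanovskii_selection ::
    "((nat \<Rightarrow> complex) \<Rightarrow> real) \<Rightarrow> ((nat \<Rightarrow> complex) \<Rightarrow> complex \<Rightarrow> nat \<Rightarrow> complex) \<Rightarrow> bool" where
  "lozanovskii_selection N B \<longleftrightarrow>
     homogeneous_selection N B \<and>
     (\<forall>u\<in>c00. l2_norm u = 1 \<longrightarrow>
        (\<exists>v w. lozanovskii_factorization N u v w \<and>
           (\<forall>z\<in>strip. \<forall>j. B u z j =
              u j * of_real (cmod (v j)) powr (1/2 - z) * of_real (cmod (w j)) powr (z - 1/2))))"

definition centralizer ::
    "((nat \<Rightarrow> complex) \<Rightarrow> complex \<Rightarrow> nat \<Rightarrow> complex) \<Rightarrow> (nat \<Rightarrow> complex) \<Rightarrow> nat \<Rightarrow> complex" where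
  "centralizer B x = (\<lambda>j. deriv (\<lambda>z. B x z j) (1/2))"

definition Z_space ::
    "((nat \<Rightarrow> complex) \<Rightarrow> nat \<Rightarrow> complex) \<Rightarrow> ((nat \<Rightarrow> complex) \<times> (nat \<Rightarrow> complex)) set" where
  "Z_space \<Omega> = {(x, y). y \<in> ell2 \<and> (\<lambda>i. x i - \<Omega> y i) \<in> ell2}"

definition Z_norm ::
    "((nat \<Rightarrow> complex) \<Rightarrow> nat \<Rightarrow> complex) \<Rightarrow> (nat \<Rightarrow> complex) \<times> (nat \<Rightarrow> complex) \<Rightarrow> real" where
  "Z_norm \<Omega> = (\<lambda>(x, y). l2_norm (\<lambda>i. x i - \<Omega> y i) + l2_norm y)"


subsection \<open>Twisted spreading models\<close>

definition normalized_blocks :: "(nat \<Rightarrow> nat \<Rightarrow> complex) \<Rightarrow> bool" where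
  "normalized_blocks u \<longleftrightarrow>
     (\<forall>j. u j \<in> c00 \<and> l2_norm (u j) = 1) \<and>
     (\<forall>j. Max (supp (u j)) < Min (supp (u (Suc j))))"

text \<open>
  The filter of the limits over \<open>\<nu> \<longlonglongrightarrow> \<infinity>\<close>, \<open>\<nu> < k\<^sub>1 < \<dots> < k\<^sub>n\<close>; only the values
  \<open>k 0, \<dots>, k (n - 1)\<close> matter.
\<close>

definition spreading_filter :: "nat \<Rightarrow> (nat \<Rightarrow> nat) filter" where
  "spreading_filter n =
     (INF \<nu>. principal {k. strict_mono_on {..<n} k \<and> (\<forall>j<n. \<nu> < k j)})"

lemma eventually_spreading_filter:
  "eventually P (spreading_filter n) \<longleftrightarrow>
     (\<exists>\<nu>. \<forall>k. strict_mono_on {..<n} k \<and> (\<forall>j<n. \<nu> < k j) \<longrightarrow> P k)"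
proof -
  define S where "S = (\<lambda>\<nu>::nat. {k. strict_mono_on {..<n} k \<and> (\<forall>j<n. \<nu> < k j)})"
  have dir: "\<exists>x\<in>UNIV. principal (S x) \<le> inf (principal (S a)) (principal (S b))" for a b
    by (intro bexI[of _ "max a b"]) (auto simp: S_def)
  have "eventually P (INF \<nu>. principal (S \<nu>)) \<longleftrightarrow> (\<exists>\<nu>. eventually P (principal (S \<nu>)))"
    by (subst eventually_INF_base) (use dir in \<open>auto simp: inf_commute\<close>)
  then show ?thesis
    by (auto simp: spreading_filter_def S_def eventually_principal)
qed

lemma spreading_filter_nontrivial: "spreading_filter n \<noteq> bot"
proof
  assume "spreading_filter n = bot"
  then have "eventually (\<lambda>_. False) (spreading_filter n)" by simp
  then obtain \<nu> where "\<not> (strict_mono_on {..<n} k \<and> (\<forall>j<n. \<nu> < k j))" for k :: "nat \<Rightarrow> nat"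
    unfolding eventually_spreading_filter by blast
  from this[of "\<lambda>j. \<nu> + 1 + j"] show False
    by (simp add: strict_mono_on_def)
qed

text \<open>
  The vector whose norm in \<open>Z\<close> is taken is the combination of the pairs \<open>(u\<^sub>k, 0)\<close> and
  \<open>(\<Omega> u\<^sub>k, u\<^sub>k)\<close> with coefficients \<open>a\<close> and \<open>b\<close>.
\<close>

definition twisted_combination ::
    "((nat \<Rightarrow> complex) \<Rightarrow> nat \<Rightarrow> complex) \<Rightarrow> (nat \<Rightarrow> nat \<Rightarrow> complex) \<Rightarrow> nat \<Rightarrow>
     (nat \<Rightarrow> complex) \<Rightarrow> (nat \<Rightarrow> complex) \<Rightarrow> (nat \<Rightarrow> nat) \<Rightarrow> (nat \<Rightarrow> complex) \<times> (nat \<Rightarrow> complex)" where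
  "twisted_combination \<Omega> u n a b k =
     (\<lambda>i. (\<Sum>j<n. a j * u (k j) i) + (\<Sum>j<n. b j * \<Omega> (u (k j)) i),
      \<lambda>i. \<Sum>j<n. b j * u (k j) i)"

text \<open>
  \<open>q\<close> is only meaningful on pairs from \<open>c00\<close>. Every \<open>n\<close> that bounds the supports gives the same
  limit.
\<close>

definition spreading_norm ::
    "((nat \<Rightarrow> complex) \<Rightarrow> nat \<Rightarrow> complex) \<Rightarrow> (nat \<Rightarrow> nat \<Rightarrow> complex) \<Rightarrow>
     ((nat \<Rightarrow> complex) \<Rightarrow> (nat \<Rightarrow> complex) \<Rightarrow> real) \<Rightarrow> bool" where
  "spreading_norm \<Omega> u q \<longleftrightarrow>
     (\<forall>n a b. supp a \<subseteq> {..<n} \<and> supp b \<subseteq> {..<n} \<longrightarrow>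
        ((\<lambda>k. Z_norm \<Omega> (twisted_combination \<Omega> u n a b k)) \<longlongrightarrow> q a b) (spreading_filter n))"

text \<open>
  A complete quasi-normed complex vector space; its carrier is the whole type.
\<close>

definition quasi_banach :: "(complex \<Rightarrow> 'y::ab_group_add \<Rightarrow> 'y) \<Rightarrow> ('y \<Rightarrow> real) \<Rightarrow> bool" where
  "quasi_banach smul qn \<longleftrightarrow>
     vector_space smul \<and>
     (\<forall>y. 0 \<le> qn y) \<and> (\<forall>y. qn y = 0 \<longleftrightarrow> y = 0) \<and>
     (\<forall>c y. qn (smul c y) = cmod c * qn y) \<and>
     (\<exists>K. \<forall>x y. qn (x + y) \<le> K * (qn x + qn y)) \<and>
     (\<forall>s :: nat \<Rightarrow> 'y. (\<forall>e>0. \<exists>M. \<forall>m\<ge>M. \<forall>n\<ge>M. qn (s m - s n) < e) \<longrightarrow>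
        (\<exists>y. (\<lambda>n. qn (s n - y)) \<longlonglongrightarrow> 0))"

text \<open>
  The space \<open>(smul, qn)\<close> is a completion of \<open>c00 \<times> c00\<close> under \<open>q\<close>: complete, with a linear,
  quasi-norm preserving map \<open>\<iota>\<close> of \<open>c00 \<times> c00\<close> onto a dense subspace.
\<close>

definition completion_c00_pair ::
    "((nat \<Rightarrow> complex) \<Rightarrow> (nat \<Rightarrow> complex) \<Rightarrow> real) \<Rightarrow>
     (complex \<Rightarrow> 'y::ab_group_add \<Rightarrow> 'y) \<Rightarrow> ('y \<Rightarrow> real) \<Rightarrow> bool" where
  "completion_c00_pair q smul qn \<longleftrightarrow>
     quasi_banach smul qn \<and>
     (\<exists>\<iota> :: (nat \<Rightarrow> complex) \<Rightarrow> (nat \<Rightarrow> complex) \<Rightarrow> 'y.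
        (\<forall>a\<in>c00. \<forall>b\<in>c00. \<forall>a'\<in>c00. \<forall>b'\<in>c00.
           \<iota> (\<lambda>j. a j + a' j) (\<lambda>j. b j + b' j) = \<iota> a b + \<iota> a' b') \<and>
        (\<forall>a\<in>c00. \<forall>b\<in>c00. \<forall>c. \<iota> (\<lambda>j. c * a j) (\<lambda>j. c * b j) = smul c (\<iota> a b)) \<and>
        (\<forall>a\<in>c00. \<forall>b\<in>c00. qn (\<iota> a b) = q a b) \<and>
        (\<forall>y. \<forall>e>0. \<exists>a\<in>c00. \<exists>b\<in>c00. qn (y - \<iota> a b) < e))"

text \<open>
  Subsequences of normalized blocks are normalized blocks, so it is enough to range over the
  sequences for which the limits exist.
\<close>

definition twisted_spreading_model ::
    "((nat \<Rightarrow> complex) \<Rightarrow> nat \<Rightarrow> complex) \<Rightarrow>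
     (complex \<Rightarrow> 'y::ab_group_add \<Rightarrow> 'y) \<Rightarrow> ('y \<Rightarrow> real) \<Rightarrow> bool" where
  "twisted_spreading_model \<Omega> smul qn \<longleftrightarrow>
     (\<exists>u q. normalized_blocks u \<and> spreading_norm \<Omega> u q \<and> completion_c00_pair q smul qn)"

definition isomorphic_to_ell2 ::
    "(complex \<Rightarrow> 'y::ab_group_add \<Rightarrow> 'y) \<Rightarrow> ('y \<Rightarrow> real) \<Rightarrow> bool" where
  "isomorphic_to_ell2 smul qn \<longleftrightarrow>
     (\<exists>T :: 'y \<Rightarrow> nat \<Rightarrow> complex.
        bij_betw T UNIV ell2 \<and>
        (\<forall>x y. T (x + y) = (\<lambda>j. T x j + T y j)) \<and>
        (\<forall>c y. T (smul c y) = (\<lambda>j. c * T y j)) \<and>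
        (\<exists>c>0. \<exists>C>0. \<forall>y. c * qn y \<le> l2_norm (T y) \<and> l2_norm (T y) \<le> C * qn y))"

end

theory Submission
  imports Defs
begin

text \<open>
  For a normalized \<open>u\<close> with Lozanovskii factors \<open>v, w\<close> one has \<open>\<Omega> u = u * ln (|w| / |v|)\<close>. Let
  \<open>u\<^sub>1 < \<dots> < u\<^sub>n\<close> be blocks supported beyond \<open>n\<close>, with factors \<open>v\<^sub>j, w\<^sub>j\<close>, and let
  \<open>u = \<Sum> b\<^sub>j u\<^sub>j\<close> with \<open>\<Sum> |b\<^sub>j|\<^sup>2 = 1\<close> have factors \<open>v, w\<close>. With \<open>p = \<Sum> b\<^sub>j v\<^sub>j\<close>,
  \<open>r = \<Sum> b\<^sub>j w\<^sub>j\<close> and \<open>t = |v| / |p| = |r| / |w|\<close> the difference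
  \<open>\<Sum> b\<^sub>j \<Omega> u\<^sub>j - \<Omega> u\<close> is \<open>2 u ln t\<close>, and \<open>(ln t)\<^sup>2 \<le> 2 (t + 1 / t)\<close>, where
  \<open>|u|\<^sup>2 (t + 1 / t) = |v r| + |p w|\<close>. The sum of the latter is bounded by duality, because
  Tsirelson's norm is equivalent to the \<open>\<ell>\<^sub>1\<close> sum on such blocks. Hence
  \<open>\<Sum> b\<^sub>j \<Omega> u\<^sub>j - \<Omega> u\<close> is bounded in \<open>\<ell>\<^sub>2\<close>, the quasi-norm of the spreading model is
  equivalent to \<open>\<parallel>a\<parallel>\<^sub>2 + \<parallel>b\<parallel>\<^sub>2\<close>, and interleaving \<open>a\<close> and \<open>b\<close> gives the isomorphism.
\<close>


subsection \<open>Sequences in \<open>\<ell>\<^sub>2\<close>\<close>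

lemma c00_subset_ell2: "c00 \<subseteq> ell2"
proof
  fix x assume "x \<in> c00"
  then have "finite {j. x j \<noteq> 0}" by (simp add: c00_def supp_def)
  then have "summable (\<lambda>j. (cmod (x j))\<^sup>2)"
    by (rule summable_finite) auto
  then show "x \<in> ell2" by (simp add: ell2_def)
qed

lemma c00_add: "x \<in> c00 \<Longrightarrow> y \<in> c00 \<Longrightarrow> (\<lambda>i. x i + y i) \<in> c00"
  unfolding c00_def supp_def
  by (auto intro: finite_subset[of _ "{j. x j \<noteq> 0} \<union> {j. y j \<noteq> 0}"])

lemma c00_diff: "x \<in> c00 \<Longrightarrow> y \<in> c00 \<Longrightarrow> (\<lambda>i. x i - y i) \<in> c00"
  unfolding c00_def supp_def
  by (auto intro: finite_subset[of _ "{j. x j \<noteq> 0} \<union> {j. y j \<noteq> 0}"])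

lemma c00_scale: "x \<in> c00 \<Longrightarrow> (\<lambda>i. c * x i) \<in> c00"
  unfolding c00_def supp_def
  by (auto intro: finite_subset[of _ "{j. x j \<noteq> 0}"])

lemma c00_sum:
  assumes "finite J" "\<And>j. j \<in> J \<Longrightarrow> f j \<in> c00"
  shows "(\<lambda>i. \<Sum>j\<in>J. f j i) \<in> c00"
  using assms
proof (induction J rule: finite_induct)
  case empty
  then show ?case by (simp add: c00_def supp_def)
next
  case (insert j J)
  then have "(\<lambda>i. f j i + (\<Sum>j\<in>J. f j i)) \<in> c00" by (intro c00_add) auto
  then show ?case using insert by simp
qed

lemma restr_c00: "finite A \<Longrightarrow> restr A x \<in> c00"
  unfolding c00_def supp_def restr_def by (auto intro: finite_subset[of _ A])

lemma L2_set_le_l2_norm: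
  assumes "x \<in> ell2" "finite A"
  shows "L2_set (\<lambda>i. cmod (x i)) A \<le> l2_norm x"
  unfolding L2_set_def l2_norm_def
  using assms by (intro real_sqrt_le_mono sum_le_suminf) (auto simp: ell2_def)

text \<open>The partial sums of squares increase, so bounds on initial segments decide both
  membership and norm. This transfers the finite inequalities for \<open>L2_set\<close> to
  \<open>ell2\<close>.\<close>

lemma ell2_boundedI:
  assumes "\<And>n. L2_set (\<lambda>i. cmod (x i)) {..<n} \<le> C"
  shows "x \<in> ell2" "l2_norm x \<le> C"
proof -
  have C: "0 \<le> C" using assms[of 0] by simp
  have b: "(\<Sum>i<n. (cmod (x i))\<^sup>2) \<le> C\<^sup>2" for n
    using assms[of n] C unfolding L2_set_def by (simp add: sqrt_le_D)
  then have s: "summable (\<lambda>i. (cmod (x i))\<^sup>2)"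
    by (intro summableI_nonneg_bounded) auto
  then show "x \<in> ell2" by (simp add: ell2_def)
  have "(\<Sum>i. (cmod (x i))\<^sup>2) \<le> C\<^sup>2" using s b by (rule suminf_le_const)
  then show "l2_norm x \<le> C" unfolding l2_norm_def using C by (simp add: real_le_lsqrt)
qed

lemma l2_norm_nonneg: "x \<in> ell2 \<Longrightarrow> 0 \<le> l2_norm x"
  using L2_set_le_l2_norm[of x "{}"] by simp

lemma cmod_le_l2_norm: "x \<in> ell2 \<Longrightarrow> cmod (x i) \<le> l2_norm x"
  using L2_set_le_l2_norm[of x "{i}"] by simp

lemma l2_norm_eq_L2_set:
  assumes "supp x \<subseteq> A" "finite A"
  shows "l2_norm x = L2_set (\<lambda>i. cmod (x i)) A"
  unfolding l2_norm_def L2_set_def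
  using assms by (subst suminf_finite[of A]) (auto simp: supp_def)

lemma
  assumes "x \<in> ell2" "y \<in> ell2"
  shows ell2_add: "(\<lambda>i. x i + y i) \<in> ell2"
    and l2_norm_triangle: "l2_norm (\<lambda>i. x i + y i) \<le> l2_norm x + l2_norm y"
proof -
  have "L2_set (\<lambda>i. cmod (x i + y i)) {..<n} \<le> l2_norm x + l2_norm y" for n
  proof -
    have "L2_set (\<lambda>i. cmod (x i + y i)) {..<n} \<le> L2_set (\<lambda>i. cmod (x i) + cmod (y i)) {..<n}"
      by (intro L2_set_mono) (auto intro: norm_triangle_ineq)
    also have "\<dots> \<le> L2_set (\<lambda>i. cmod (x i)) {..<n} + L2_set (\<lambda>i. cmod (y i)) {..<n}"
      by (rule L2_set_triangle_ineq)
    also have "\<dots> \<le> l2_norm x + l2_norm y"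
      using assms by (intro add_mono L2_set_le_l2_norm) auto
    finally show ?thesis .
  qed
  from ell2_boundedI[of "\<lambda>i. x i + y i", OF this]
  show "(\<lambda>i. x i + y i) \<in> ell2" "l2_norm (\<lambda>i. x i + y i) \<le> l2_norm x + l2_norm y" by auto
qed

lemma ell2_scale: "x \<in> ell2 \<Longrightarrow> (\<lambda>i. c * x i) \<in> ell2"
  by (simp add: ell2_def norm_mult power_mult_distrib summable_mult)

lemma l2_norm_scale: "x \<in> ell2 \<Longrightarrow> l2_norm (\<lambda>i. c * x i) = cmod c * l2_norm x"
  by (simp add: ell2_def l2_norm_def norm_mult power_mult_distrib suminf_mult real_sqrt_mult)

lemma
  assumes "x \<in> ell2" "y \<in> ell2"
  shows ell2_diff: "(\<lambda>i. x i - y i) \<in> ell2"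
    and l2_norm_diff_triangle: "l2_norm (\<lambda>i. x i - y i) \<le> l2_norm x + l2_norm y"
  using ell2_add[OF assms(1) ell2_scale[OF assms(2), of "-1"]]
    l2_norm_triangle[OF assms(1) ell2_scale[OF assms(2), of "-1"]]
    l2_norm_scale[OF assms(2), of "-1"] by auto

text \<open>The squared distance is the tail of a convergent series. The truncations thus
  approximate \<open>x\<close> from \<open>c00\<close>, which is how maps on \<open>c00\<close> are
  later extended to \<open>ell2\<close>.\<close>

lemma l2_norm_tail_tendsto_0:
  assumes "x \<in> ell2"
  shows "(\<lambda>n. l2_norm (\<lambda>i. restr {..<n} x i - x i)) \<longlonglongrightarrow> 0"
proof -
  let ?f = "\<lambda>i. (cmod (x i))\<^sup>2"
  have s: "summable ?f" using assms by (simp add: ell2_def)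
  have "l2_norm (\<lambda>i. restr {..<n} x i - x i) = sqrt (suminf ?f - (\<Sum>i<n. ?f i))" for n
  proof -
    let ?g = "\<lambda>i. (cmod (restr {..<n} x i - x i))\<^sup>2"
    have "(\<lambda>i. ?f i - (if i \<in> {..<n} then ?f i else 0)) sums (suminf ?f - (\<Sum>i<n. ?f i))"
      by (intro sums_diff summable_sums s sums_If_finite_set) auto
    moreover have "(\<lambda>i. ?f i - (if i \<in> {..<n} then ?f i else 0)) = ?g"
      by (auto simp: restr_def)
    ultimately show ?thesis unfolding l2_norm_def by (simp add: sums_iff)
  qed
  moreover have "(\<lambda>n. sqrt (suminf ?f - (\<Sum>i<n. ?f i))) \<longlonglongrightarrow> sqrt (suminf ?f - suminf ?f)"
    by (intro tendsto_intros summable_LIMSEQ s)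
  ultimately show ?thesis by simp
qed

text \<open>The limit is taken coordinatewise. On each finite section the Cauchy estimate survives
  the passage to the limit, and \<open>ell2_boundedI\<close> reassembles the sections.\<close>

lemma ell2_complete:
  assumes x: "\<And>n. x n \<in> ell2"
    and cauchy: "\<And>e. e > 0 \<Longrightarrow> \<exists>M. \<forall>m\<ge>M. \<forall>n\<ge>M. l2_norm (\<lambda>i. x m i - x n i) < e"
  obtains y where "y \<in> ell2" "(\<lambda>n. l2_norm (\<lambda>i. x n i - y i)) \<longlonglongrightarrow> 0"
proof -
  have "Cauchy (\<lambda>n. x n i)" for i
  proof (rule metric_CauchyI)
    fix e :: real assume "e > 0"
    with cauchy obtain M where "\<forall>m\<ge>M. \<forall>n\<ge>M. l2_norm (\<lambda>i. x m i - x n i) < e" by blast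
    moreover have "dist (x m i) (x n i) \<le> l2_norm (\<lambda>i. x m i - x n i)" for m n
      unfolding dist_norm by (rule cmod_le_l2_norm[OF ell2_diff[OF x x]])
    ultimately show "\<exists>M. \<forall>m\<ge>M. \<forall>n\<ge>M. dist (x m i) (x n i) < e"
      by (meson le_less_trans)
  qed
  then have "convergent (\<lambda>n. x n i)" for i by (rule Cauchy_convergent)
  then have y: "(\<lambda>n. x n i) \<longlonglongrightarrow> lim (\<lambda>n. x n i)" for i by (simp add: convergent_LIMSEQ_iff)
  define y where "y i = lim (\<lambda>n. x n i)" for i
  have y: "(\<lambda>n. x n i) \<longlonglongrightarrow> y i" for i unfolding y_def by (rule y)
  have key: "\<exists>M. \<forall>m\<ge>M. (\<lambda>i. x m i - y i) \<in> ell2 \<and> l2_norm (\<lambda>i. x m i - y i) \<le> e"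
    if "e > 0" for e
  proof -
    from that cauchy obtain M where M: "\<forall>m\<ge>M. \<forall>n\<ge>M. l2_norm (\<lambda>i. x m i - x n i) < e" by blast
    have "L2_set (\<lambda>i. cmod (x m i - y i)) {..<k} \<le> e" if m: "m \<ge> M" for m k
    proof (rule tendsto_upperbound)
      show "(\<lambda>n. L2_set (\<lambda>i. cmod (x m i - x n i)) {..<k})
          \<longlonglongrightarrow> L2_set (\<lambda>i. cmod (x m i - y i)) {..<k}"
        unfolding L2_set_def by (intro tendsto_intros y)
      show "\<forall>\<^sub>F n in sequentially. L2_set (\<lambda>i. cmod (x m i - x n i)) {..<k} \<le> e"
        using eventually_ge_at_top[of M]
      proof eventually_elim
        case (elim n)
        have "L2_set (\<lambda>i. cmod (x m i - x n i)) {..<k} \<le> l2_norm (\<lambda>i. x m i - x n i)"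
          by (rule L2_set_le_l2_norm[OF ell2_diff[OF x x]]) auto
        also have "\<dots> \<le> e" using M m elim by (auto intro: less_imp_le)
        finally show ?case .
      qed
    qed auto
    then show ?thesis by (intro exI[of _ M]) (auto intro!: ell2_boundedI)
  qed
  \<comment> \<open>The limit is recovered as \<open>x M - (x M - y)\<close>, a difference of two
    members of \<open>ell2\<close>.\<close>
  from key[of 1] obtain M where "(\<lambda>i. x M i - y i) \<in> ell2" by auto
  from ell2_diff[OF x[of M] this] have "y \<in> ell2" by simp
  moreover have "(\<lambda>n. l2_norm (\<lambda>i. x n i - y i)) \<longlonglongrightarrow> 0"
  proof (rule LIMSEQ_I)
    fix e :: real assume "e > 0"
    from key[of "e/2"] this obtain M
      where "\<forall>m\<ge>M. (\<lambda>i. x m i - y i) \<in> ell2 \<and> l2_norm (\<lambda>i. x m i - y i) \<le> e/2" by auto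
    then show "\<exists>M. \<forall>n\<ge>M. norm (l2_norm (\<lambda>i. x n i - y i) - 0) < e"
      using \<open>e > 0\<close> l2_norm_nonneg by (intro exI[of _ M]) fastforce
  qed
  ultimately show ?thesis using that by blast
qed

section \<open>Extension of isomorphic embeddings from \<open>c00\<close> to
  \<open>ell2\<close>\<close>

text \<open>\<open>S\<close> is extended to \<open>ell2\<close> by completeness of the target. The
  lower bound makes the extension injective and its range closed, density makes it onto, and its
  inverse is the required isomorphism. A quasi-norm need not be continuous, so estimates passing to
  a limit lose the factor \<open>K\<close> of the quasi-triangle inequality.\<close>

lemma isomorphic_to_ell2_if_dense_image:
  fixes smul :: "complex \<Rightarrow> 'y::ab_group_add \<Rightarrow> 'y"
  assumes qb: "quasi_banach smul qn"
    and S_add: "\<And>x y. x \<in> c00 \<Longrightarrow> y \<in> c00 \<Longrightarrow> S (\<lambda>i. x i + y i) = S x + S y"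
    and S_scale: "\<And>c x. x \<in> c00 \<Longrightarrow> S (\<lambda>i. c * x i) = smul c (S x)"
    and m: "0 < m" and lower: "\<And>x. x \<in> c00 \<Longrightarrow> m * l2_norm x \<le> qn (S x)"
    and M: "0 < M" and upper: "\<And>x. x \<in> c00 \<Longrightarrow> qn (S x) \<le> M * l2_norm x"
    and dense: "\<And>y e. e > 0 \<Longrightarrow> \<exists>x\<in>c00. qn (y - S x) < e"
  shows "isomorphic_to_ell2 smul qn"
proof -
  interpret vector_space smul using qb by (simp add: quasi_banach_def)
  from qb obtain K0 where K0: "\<And>x y. qn (x + y) \<le> K0 * (qn x + qn y)"
    by (auto simp: quasi_banach_def)
  have nonneg: "0 \<le> qn y" and zero: "qn y = 0 \<longleftrightarrow> y = 0"
    and scale: "qn (smul c y) = cmod c * qn y" for c y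
    using qb by (auto simp: quasi_banach_def)
  have complete: "\<exists>y. (\<lambda>n. qn (s n - y)) \<longlonglongrightarrow> 0"
    if "\<forall>e>0. \<exists>M. \<forall>m\<ge>M. \<forall>n\<ge>M. qn (s m - s n) < e" for s :: "nat \<Rightarrow> 'y"
    using qb that by (auto simp: quasi_banach_def)
  \<comment> \<open>The given constant may fail to be positive; a constant at least 1 can be used
    for monotonicity and for division.\<close>
  define K where "K = max K0 1"
  have K: "1 \<le> K" by (simp add: K_def)
  have tri: "qn (x + y) \<le> K * (qn x + qn y)" for x y
    using K0[of x y] mult_right_mono[of K0 K "qn x + qn y"] nonneg[of x] nonneg[of y]
    by (simp add: K_def)
  have minus: "qn (- y) = qn y" for y
    using scale[of "-1" y] by simp
  have swap: "qn (x - y) = qn (y - x)" for x y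
    using minus[of "x - y"] by simp
  have tri': "qn (x - z) \<le> K * (qn (x - y) + qn (y - z))" for x y z
    using tri[of "x - y" "y - z"] by simp
  \<comment> \<open>Limits with respect to \<open>qn\<close> are unique; the values of the extension
    \<open>E\<close> below are identified through this fact.\<close>
  have unique: "y = y'"
    if "(\<lambda>n. qn (s n - y)) \<longlonglongrightarrow> 0" "(\<lambda>n. qn (s n - y')) \<longlonglongrightarrow> 0" for s y y'
  proof -
    have "(\<lambda>n. K * (qn (s n - y) + qn (s n - y'))) \<longlonglongrightarrow> K * (0 + 0)"
      by (intro tendsto_intros that)
    then have "qn (y - y') \<le> K * (0 + 0)"
      by (rule tendsto_lowerbound) (use tri'[of y y'] in \<open>auto simp: swap[of y]\<close>)
    then show ?thesis using nonneg[of "y - y'"] zero[of "y - y'"] by simp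
  qed
  have null: "(\<lambda>n. qn (f n)) \<longlonglongrightarrow> 0"
    if "g \<longlonglongrightarrow> 0" "\<And>n. qn (f n) \<le> g n" for f :: "nat \<Rightarrow> 'y" and g
    using tendsto_sandwich[OF _ _ tendsto_const that(1), of "\<lambda>n. qn (f n)"] nonneg that(2) by auto
  have S_diff: "S (\<lambda>i. x i - y i) = S x - S y" if "x \<in> c00" "y \<in> c00" for x y
    using S_add[OF that(1) c00_scale[OF that(2), of "-1"]] S_scale[OF that(2), of "-1"]
    by simp
  let ?r = "\<lambda>n x. restr {..<n::nat} x"
  have r: "?r n x \<in> c00" for n x by (rule restr_c00) simp
  have r2: "?r n x \<in> ell2" for n x using r c00_subset_ell2 by blast
  have ex: "\<exists>y. (\<lambda>n. qn (S (?r n x) - y)) \<longlonglongrightarrow> 0" if x: "x \<in> ell2" for x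
  proof (rule complete, intro allI impI)
    fix e :: real assume e: "e > 0"
    have "(\<lambda>n. l2_norm (\<lambda>i. ?r n x i - x i)) \<longlonglongrightarrow> 0" by (rule l2_norm_tail_tendsto_0[OF x])
    from LIMSEQ_D[OF this, of "e / (2 * M)"] e M obtain N
      where N: "\<And>n. n \<ge> N \<Longrightarrow> l2_norm (\<lambda>i. ?r n x i - x i) < e / (2 * M)"
      by (auto simp: abs_less_iff)
    have "qn (S (?r k x) - S (?r n x)) < e" if "k \<ge> N" "n \<ge> N" for k n
    proof -
      have "l2_norm (\<lambda>i. ?r k x i - ?r n x i)
          \<le> l2_norm (\<lambda>i. ?r k x i - x i) + l2_norm (\<lambda>i. ?r n x i - x i)"
        using l2_norm_diff_triangle[OF ell2_diff[OF r2 x] ell2_diff[OF r2 x], of k x n x] by simp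
      also have "\<dots> < e / (2 * M) + e / (2 * M)" using N that by (intro add_strict_mono) auto
      finally have "M * l2_norm (\<lambda>i. ?r k x i - ?r n x i) < e"
        using M by (simp add: field_simps)
      then show ?thesis
        using upper[OF c00_diff[OF r r], of k x n x] by (simp add: S_diff[OF r r])
    qed
    then show "\<exists>N. \<forall>k\<ge>N. \<forall>n\<ge>N. qn (S (?r k x) - S (?r n x)) < e" by blast
  qed
  \<comment> \<open>Truncations of \<open>x\<close> are Cauchy in \<open>ell2\<close>, hence by
    \<open>upper\<close> their images are Cauchy for \<open>qn\<close>; \<open>E x\<close> is the
    limit of these images.\<close>
  define E where "E x = (SOME y. (\<lambda>n. qn (S (?r n x) - y)) \<longlonglongrightarrow> 0)" for x
  have E: "(\<lambda>n. qn (S (?r n x) - E x)) \<longlonglongrightarrow> 0" if "x \<in> ell2" for x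
    unfolding E_def by (rule someI_ex[OF ex[OF that]])
  have E_eq: "E x = y" if "x \<in> ell2" "(\<lambda>n. qn (S (?r n x) - y)) \<longlonglongrightarrow> 0" for x y
    using unique[OF E[OF that(1)] that(2)] .
  have E_c00: "E x = S x" if x: "x \<in> c00" for x
  proof (rule E_eq)
    show x2: "x \<in> ell2" using x c00_subset_ell2 by blast
    have "(\<lambda>n. M * l2_norm (\<lambda>i. ?r n x i - x i)) \<longlonglongrightarrow> M * 0"
      by (intro tendsto_intros l2_norm_tail_tendsto_0[OF x2])
    moreover have "qn (S (?r n x) - S x) \<le> M * l2_norm (\<lambda>i. ?r n x i - x i)" for n
      using upper[OF c00_diff[OF r x], of n x] by (simp add: S_diff[OF r x])
    ultimately show "(\<lambda>n. qn (S (?r n x) - S x)) \<longlonglongrightarrow> 0"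
      by (intro null) simp_all
  qed
  have E_add: "E (\<lambda>i. x i + y i) = E x + E y" if x: "x \<in> ell2" and y: "y \<in> ell2" for x y
  proof (rule E_eq[OF ell2_add[OF x y]])
    have "(\<lambda>n. K * (qn (S (?r n x) - E x) + qn (S (?r n y) - E y))) \<longlonglongrightarrow> K * (0 + 0)"
      by (intro tendsto_intros E x y)
    moreover have "qn (S (?r n (\<lambda>i. x i + y i)) - (E x + E y))
        \<le> K * (qn (S (?r n x) - E x) + qn (S (?r n y) - E y))" for n
    proof -
      have "?r n (\<lambda>i. x i + y i) = (\<lambda>i. ?r n x i + ?r n y i)" by (auto simp: restr_def)
      then have "S (?r n (\<lambda>i. x i + y i)) = S (?r n x) + S (?r n y)"
        by (simp add: S_add[OF r r])
      then show ?thesis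
        using tri[of "S (?r n x) - E x" "S (?r n y) - E y"] by (simp add: algebra_simps)
    qed
    ultimately show "(\<lambda>n. qn (S (?r n (\<lambda>i. x i + y i)) - (E x + E y))) \<longlonglongrightarrow> 0"
      by (intro null) simp_all
  qed
  have E_scale: "E (\<lambda>i. c * x i) = smul c (E x)" if x: "x \<in> ell2" for c x
  proof (rule E_eq[OF ell2_scale[OF x]])
    have "(\<lambda>n. cmod c * qn (S (?r n x) - E x)) \<longlonglongrightarrow> cmod c * 0"
      by (intro tendsto_intros E x)
    moreover have "qn (S (?r n (\<lambda>i. c * x i)) - smul c (E x)) = cmod c * qn (S (?r n x) - E x)" for n
    proof -
      have "?r n (\<lambda>i. c * x i) = (\<lambda>i. c * ?r n x i)" by (auto simp: restr_def)
      then have "S (?r n (\<lambda>i. c * x i)) = smul c (S (?r n x))"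
        by (simp add: S_scale[OF r])
      then show ?thesis
        using scale[of c "S (?r n x) - E x"] by (simp add: scale_right_diff_distrib)
    qed
    ultimately show "(\<lambda>n. qn (S (?r n (\<lambda>i. c * x i)) - smul c (E x))) \<longlonglongrightarrow> 0" by simp
  qed
  have E_diff: "E (\<lambda>i. x i - y i) = E x - E y" if "x \<in> ell2" "y \<in> ell2" for x y
    using E_add[OF that(1) ell2_scale[OF that(2), of "-1"]] E_scale[OF that(2), of "-1"]
    by simp
  have norm_r: "(\<lambda>n. l2_norm (?r n x)) \<longlonglongrightarrow> l2_norm x" if x: "x \<in> ell2" for x
  proof (rule LIMSEQ_I)
    fix e :: real assume "e > 0"
    from LIMSEQ_D[OF l2_norm_tail_tendsto_0[OF x] this] obtain N
      where N: "\<And>n. n \<ge> N \<Longrightarrow> l2_norm (\<lambda>i. ?r n x i - x i) < e" by (auto simp: abs_less_iff)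
    have "\<bar>l2_norm (?r n x) - l2_norm x\<bar> \<le> l2_norm (\<lambda>i. ?r n x i - x i)" for n
      using l2_norm_triangle[OF ell2_diff[OF r2 x] x, of n x]
        l2_norm_diff_triangle[OF r2 ell2_diff[OF r2 x], of n x n x] by simp
    with N show "\<exists>N. \<forall>n\<ge>N. norm (l2_norm (?r n x) - l2_norm x) < e"
      by (intro exI[of _ N]) (auto intro: le_less_trans)
  qed
  have E_upper: "qn (E x) \<le> K * M * l2_norm x" if x: "x \<in> ell2" for x
  proof -
    have "(\<lambda>n. K * (M * l2_norm (?r n x) + qn (S (?r n x) - E x))) \<longlonglongrightarrow> K * (M * l2_norm x + 0)"
      by (intro tendsto_intros norm_r E x)
    then have "qn (E x) \<le> K * (M * l2_norm x + 0)"
    proof (rule tendsto_lowerbound, intro always_eventually allI)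
      fix n
      have "qn (E x) \<le> K * (qn (S (?r n x)) + qn (S (?r n x) - E x))"
        using tri[of "S (?r n x)" "E x - S (?r n x)"] swap[of "E x"] by simp
      also have "\<dots> \<le> K * (M * l2_norm (?r n x) + qn (S (?r n x) - E x))"
        using K upper[OF r] by (intro mult_left_mono add_mono) auto
      finally show "qn (E x) \<le> K * (M * l2_norm (?r n x) + qn (S (?r n x) - E x))" .
    qed simp
    then show ?thesis by simp
  qed
  have E_lower: "m * l2_norm x \<le> K * qn (E x)" if x: "x \<in> ell2" for x
  proof -
    have 1: "(\<lambda>n. m * l2_norm (?r n x)) \<longlonglongrightarrow> m * l2_norm x"
      by (intro tendsto_intros norm_r x)
    have 2: "(\<lambda>n. K * (qn (E x) + qn (S (?r n x) - E x))) \<longlonglongrightarrow> K * (qn (E x) + 0)"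
      by (intro tendsto_intros E x)
    have "m * l2_norm x \<le> K * (qn (E x) + 0)"
    proof (rule LIMSEQ_le[OF 1 2], intro exI allI impI)
      fix n
      show "m * l2_norm (?r n x) \<le> K * (qn (E x) + qn (S (?r n x) - E x))"
        using lower[OF r, of n x] tri[of "E x" "S (?r n x) - E x"] by simp
    qed
    then show ?thesis by simp
  qed
  have inj: "inj_on E ell2"
  proof (rule inj_onI)
    fix x y assume x: "x \<in> ell2" and y: "y \<in> ell2" and eq: "E x = E y"
    have "m * l2_norm (\<lambda>i. x i - y i) \<le> K * 0"
      using E_lower[OF ell2_diff[OF x y]] E_diff[OF x y] eq zero[of 0] by simp
    then have "l2_norm (\<lambda>i. x i - y i) \<le> 0" using m by (simp add: mult_le_0_iff)
    then have "cmod (x i - y i) \<le> 0" for i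
      using cmod_le_l2_norm[OF ell2_diff[OF x y], of i] by (rule order_trans[rotated])
    then show "x = y" by auto
  qed
  \<comment> \<open>Approximations of \<open>y\<close> by images of \<open>c00\<close> have
    preimages that are Cauchy by the lower bound; the limit of the preimages is mapped to
    \<open>y\<close>.\<close>
  have surj: "\<exists>x\<in>ell2. E x = y" for y
  proof -
    have "\<exists>x\<in>c00. qn (y - S x) < 1 / real (Suc n)" for n
      by (rule dense) simp
    then obtain x where x: "\<And>n. x n \<in> c00" and xy: "\<And>n. qn (y - S (x n)) < 1 / real (Suc n)"
      by metis
    have x2: "x n \<in> ell2" for n using x c00_subset_ell2 by blast
    have lim0: "(\<lambda>n. qn (S (x n) - y)) \<longlonglongrightarrow> 0"
      using xy swap[of y]
      by (intro null[OF LIMSEQ_inverse_real_of_nat]) (simp add: inverse_eq_divide less_imp_le)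
    have "\<exists>N. \<forall>k\<ge>N. \<forall>n\<ge>N. l2_norm (\<lambda>i. x k i - x n i) < e" if e: "e > 0" for e
    proof -
      from LIMSEQ_D[OF lim0, of "m * e / (2 * K)"] e m K obtain N
        where N: "\<And>n. n \<ge> N \<Longrightarrow> qn (S (x n) - y) < m * e / (2 * K)" by (auto simp: abs_less_iff)
      have "l2_norm (\<lambda>i. x k i - x n i) < e" if "k \<ge> N" "n \<ge> N" for k n
      proof -
        have "m * l2_norm (\<lambda>i. x k i - x n i) \<le> qn (S (x k) - S (x n))"
          using lower[OF c00_diff[OF x x]] S_diff[OF x x] by simp
        also have "\<dots> \<le> K * (qn (S (x k) - y) + qn (S (x n) - y))"
          using tri'[of "S (x k)" "S (x n)" y] swap[of y] by simp
        also have "\<dots> < K * (m * e / (2 * K) + m * e / (2 * K))"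
          using N that K by (intro mult_strict_left_mono add_strict_mono) auto
        also have "\<dots> = m * e" using K by (simp add: field_simps)
        finally show ?thesis using m by simp
      qed
      then show ?thesis by blast
    qed
    from ell2_complete[of x, OF x2 this] obtain z
      where z: "z \<in> ell2" and lim: "(\<lambda>n. l2_norm (\<lambda>i. x n i - z i)) \<longlonglongrightarrow> 0" by blast
    have "(\<lambda>n. K * M * l2_norm (\<lambda>i. x n i - z i)) \<longlonglongrightarrow> K * M * 0"
      by (intro tendsto_intros lim)
    moreover have "qn (S (x n) - E z) \<le> K * M * l2_norm (\<lambda>i. x n i - z i)" for n
      using E_upper[OF ell2_diff[OF x2 z], of n] E_diff[OF x2 z, of n] E_c00[OF x] by simp
    ultimately have "(\<lambda>n. qn (S (x n) - E z)) \<longlonglongrightarrow> 0"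
      by (intro null) simp_all
    from unique[OF this lim0] z show ?thesis by blast
  qed
  have bij: "bij_betw E ell2 UNIV"
    unfolding bij_betw_def using inj surj by (auto simp: image_iff) metis
  define T where "T = inv_into ell2 E"
  have "y \<in> E ` ell2" for y using surj by (metis imageI)
  then have T_ell2: "T y \<in> ell2" and ET: "E (T y) = y" for y
    unfolding T_def by (rule inv_into_into, rule f_inv_into_f)
  have TE: "T (E x) = x" if "x \<in> ell2" for x
    unfolding T_def using inj that by simp
  show ?thesis
    unfolding isomorphic_to_ell2_def
  proof (intro exI[of _ T] conjI allI)
    show "bij_betw T UNIV ell2"
      unfolding T_def by (rule bij_betw_inv_into[OF bij])
    show "T (x + y) = (\<lambda>j. T x j + T y j)" for x y
      using TE[OF ell2_add[OF T_ell2 T_ell2]] E_add[OF T_ell2 T_ell2] by (simp add: ET)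
    show "T (smul c y) = (\<lambda>j. c * T y j)" for c y
      using TE[OF ell2_scale[OF T_ell2]] E_scale[OF T_ell2] by (simp add: ET)
    have "1 / (K * M) * qn y \<le> l2_norm (T y)" "l2_norm (T y) \<le> K / m * qn y" for y
      using E_upper[OF T_ell2, of y] E_lower[OF T_ell2, of y] m M K
      by (auto simp: ET field_simps)
    then show "\<exists>c>0. \<exists>C>0. \<forall>y. c * qn y \<le> l2_norm (T y) \<and> l2_norm (T y) \<le> C * qn y"
      using m M K by (intro exI[of _ "1 / (K * M)"] exI[of _ "K / m"] conjI) auto
  qed
qed


subsection \<open>Tsirelson's norm and its 2-convexification\<close>

text \<open>An a priori bound for the iterates: it keeps the real suprema in
  \<open>tsirelson_iter\<close> meaningful and makes the limit in \<open>tsirelson_norm\<close>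
  exist.\<close>

definition l1_norm :: "(nat \<Rightarrow> complex) \<Rightarrow> real" where
  "l1_norm x = (\<Sum>j\<in>supp x. cmod (x j))"

lemma l1_norm_eq: "finite A \<Longrightarrow> supp x \<subseteq> A \<Longrightarrow> l1_norm x = (\<Sum>j\<in>A. cmod (x j))"
  unfolding l1_norm_def by (rule sum.mono_neutral_left) (auto simp: supp_def)

lemma restr_in_c00: "x \<in> c00 \<Longrightarrow> restr A x \<in> c00"
  unfolding c00_def supp_def restr_def
  by (auto intro: finite_subset[of _ "{j. x j \<noteq> 0}"])

text \<open>Admissibility compares neighbours only; nonemptiness gives
  \<open>Min (A j) \<le> Max (A j)\<close>, which chains the comparisons.\<close>

lemma successive_sets_less:
  fixes A :: "nat \<Rightarrow> nat set"
  assumes fin: "\<And>j. j < k \<Longrightarrow> finite (A j) \<and> A j \<noteq> {}"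
    and step: "\<And>j. Suc j < k \<Longrightarrow> Max (A j) < Min (A (Suc j))"
    and "i < j" "j < k"
  shows "Max (A i) < Min (A j)"
  using assms(3,4)
proof (induction j)
  case (Suc j)
  show ?case
  proof (cases "i = j")
    case False
    then have "Max (A i) < Min (A j)" using Suc by simp
    also have "\<dots> \<le> Max (A j)" using fin[of j] Suc.prems by simp
    also have "\<dots> < Min (A (Suc j))" using step Suc.prems by simp
    finally show ?thesis .
  qed (use step Suc.prems in simp)
qed simp

lemma successive_sets_disjoint:
  fixes A :: "nat \<Rightarrow> nat set"
  assumes fin: "\<And>j. j < k \<Longrightarrow> finite (A j) \<and> A j \<noteq> {}"
    and step: "\<And>j. Suc j < k \<Longrightarrow> Max (A j) < Min (A (Suc j))"
  shows "disjoint_family_on A {..<k}"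
proof -
  have "A i \<inter> A j = {}" if "i < j" "j < k" for i j
  proof -
    have "Max (A i) < Min (A j)" using successive_sets_less[of k A i j] assms that by blast
    then show ?thesis using fin[of i] fin[of j] that
      by (metis disjoint_iff Max_ge Min_le leD le_less_trans less_trans order.trans)
  qed
  then show ?thesis
    unfolding disjoint_family_on_def by (metis inf_commute lessThan_iff linorder_neqE_nat)
qed

lemma admissible_disjoint: "admissible k A \<Longrightarrow> disjoint_family_on A {..<k}"
  by (rule successive_sets_disjoint) (auto simp: admissible_def)

text \<open>Some admissible family must exist, since \<open>cSUP_least\<close> needs a nonempty
  index set. The index 0 stands for position 1, so the condition \<open>k \<le> A 0\<close> holds
  for \<open>k = 1\<close>.\<close>

lemma admissible_singleton: "admissible 1 (\<lambda>_. {0})"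
  by (simp add: admissible_def)

lemma sum_l1_norm_restr_le:
  assumes "x \<in> c00" "admissible k A"
  shows "(\<Sum>j<k. l1_norm (restr (A j) x)) \<le> l1_norm x"
proof -
  have fin: "finite (supp x)" using assms by (simp add: c00_def)
  have "(\<Sum>j<k. l1_norm (restr (A j) x)) = (\<Sum>j<k. \<Sum>i\<in>A j \<inter> supp x. cmod (x i))"
  proof (rule sum.cong[OF refl])
    fix j
    have "supp (restr (A j) x) = A j \<inter> supp x" by (auto simp: supp_def restr_def)
    then show "l1_norm (restr (A j) x) = (\<Sum>i\<in>A j \<inter> supp x. cmod (x i))"
      unfolding l1_norm_def by (auto simp: restr_def intro!: sum.cong)
  qed
  also have "\<dots> = (\<Sum>i\<in>(\<Union>j<k. A j \<inter> supp x). cmod (x i))"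
    using admissible_disjoint[OF assms(2)] fin
    by (intro sum.UNION_disjoint[symmetric]) (fastforce simp: disjoint_family_on_def)+
  also have "\<dots> \<le> (\<Sum>i\<in>supp x. cmod (x i))"
    using fin by (intro sum_mono2) auto
  finally show ?thesis by (simp add: l1_norm_def)
qed

lemma cmod_le_l1_norm:
  assumes "x \<in> c00"
  shows "cmod (x j) \<le> l1_norm x"
proof (cases "j \<in> supp x")
  case True
  then show ?thesis unfolding l1_norm_def
    using assms by (intro member_le_sum) (auto simp: c00_def)
qed (auto simp: supp_def l1_norm_def intro: sum_nonneg)

lemma bdd_above_cmod_c00: "x \<in> c00 \<Longrightarrow> bdd_above (range (\<lambda>j. cmod (x j)))"
  by (rule bdd_aboveI2[OF cmod_le_l1_norm])

abbreviation admissible_sum :: "nat \<Rightarrow> (nat \<Rightarrow> complex) \<Rightarrow> nat \<times> (nat \<Rightarrow> nat set) \<Rightarrow> real" where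
  "admissible_sum n x \<equiv> \<lambda>(k, A). \<Sum>j<k. tsirelson_iter n (restr (A j) x)"

lemma SUP_admissible_le:
  assumes "\<And>k A. admissible k A \<Longrightarrow> admissible_sum n x (k, A) \<le> C"
  shows "(SUP (k, A) \<in> {(k, A). admissible k A}. \<Sum>j<k. tsirelson_iter n (restr (A j) x)) \<le> C"
proof (rule cSUP_least)
  show "{(k, A). admissible k A} \<noteq> {}" using admissible_singleton by blast
qed (use assms in auto)

text \<open>Induction on \<open>n\<close>: the sets of an admissible family are disjoint, so the
  bounds for the restrictions add up to at most \<open>l1_norm x\<close>.\<close>

lemma tsirelson_iter_bounds: "x \<in> c00 \<Longrightarrow> 0 \<le> tsirelson_iter n x \<and> tsirelson_iter n x \<le> l1_norm x"
proof (induction n arbitrary: x)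
  case 0
  have "cmod (x 0) \<le> (SUP j. cmod (x j))"
    by (rule cSUP_upper[OF UNIV_I bdd_above_cmod_c00[OF 0]])
  then have "0 \<le> (SUP j. cmod (x j))" using norm_ge_zero order_trans by blast
  moreover have "(SUP j. cmod (x j)) \<le> l1_norm x"
    using cmod_le_l1_norm[OF 0] by (intro cSUP_least) auto
  ultimately show ?case by simp
next
  case (Suc n)
  have "admissible_sum n x (k, A) \<le> l1_norm x" if "admissible k A" for k A
  proof -
    have "admissible_sum n x (k, A) \<le> (\<Sum>j<k. l1_norm (restr (A j) x))"
      using Suc.IH[OF restr_in_c00[OF Suc.prems]] by (auto intro!: sum_mono)
    also have "\<dots> \<le> l1_norm x" by (rule sum_l1_norm_restr_le[OF Suc.prems that])
    finally show ?thesis .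
  qed
  from SUP_admissible_le[of n x, OF this] Suc.IH[OF Suc.prems] show ?case
    by (simp add: le_max_iff_disj)
qed

lemma bdd_above_admissible_sum:
  assumes "x \<in> c00"
  shows "bdd_above (admissible_sum n x ` {(k, A). admissible k A})"
proof (rule bdd_aboveI2)
  fix p :: "nat \<times> (nat \<Rightarrow> nat set)" assume "p \<in> {(k, A). admissible k A}"
  then obtain k A where p: "p = (k, A)" "admissible k A" by auto
  have "admissible_sum n x p \<le> (\<Sum>j<k. l1_norm (restr (A j) x))"
    using tsirelson_iter_bounds[OF restr_in_c00[OF assms]] p by (auto intro!: sum_mono)
  also have "\<dots> \<le> l1_norm x" by (rule sum_l1_norm_restr_le[OF assms p(2)])
  finally show "admissible_sum n x p \<le> l1_norm x" .
qed

text \<open>The recursion read as a lower estimate; the supremum dominates its terms because it is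
  taken over a bounded set.\<close>

lemma admissible_sum_le_iter_Suc:
  assumes "x \<in> c00" "admissible k A"
  shows "(\<Sum>j<k. tsirelson_iter n (restr (A j) x)) \<le> 2 * tsirelson_iter (Suc n) x"
proof -
  have "admissible_sum n x (k, A)
      \<le> (SUP (k, A) \<in> {(k, A). admissible k A}. \<Sum>j<k. tsirelson_iter n (restr (A j) x))"
    using assms by (intro cSUP_upper bdd_above_admissible_sum) auto
  then show ?thesis by simp
qed

lemma tsirelson_iter_triangle:
  "x \<in> c00 \<Longrightarrow> y \<in> c00 \<Longrightarrow>
     tsirelson_iter n (\<lambda>i. x i + y i) \<le> tsirelson_iter n x + tsirelson_iter n y"
proof (induction n arbitrary: x y)
  case 0
  have "(SUP j. cmod (x j + y j)) \<le> (SUP j. cmod (x j)) + (SUP j. cmod (y j))"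
  proof (rule cSUP_least)
    fix j
    have "cmod (x j + y j) \<le> cmod (x j) + cmod (y j)" by (rule norm_triangle_ineq)
    also have "\<dots> \<le> (SUP j. cmod (x j)) + (SUP j. cmod (y j))"
      using 0 by (intro add_mono cSUP_upper bdd_above_cmod_c00) auto
    finally show "cmod (x j + y j) \<le> (SUP j. cmod (x j)) + (SUP j. cmod (y j))" .
  qed simp
  then show ?case by simp
next
  case (Suc n)
  have "admissible_sum n (\<lambda>i. x i + y i) (k, A)
      \<le> 2 * (tsirelson_iter (Suc n) x + tsirelson_iter (Suc n) y)" if "admissible k A" for k A
  proof -
    have "restr (A j) (\<lambda>i. x i + y i) = (\<lambda>i. restr (A j) x i + restr (A j) y i)" for j
      by (auto simp: restr_def)
    then have "admissible_sum n (\<lambda>i. x i + y i) (k, A)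
        \<le> (\<Sum>j<k. tsirelson_iter n (restr (A j) x) + tsirelson_iter n (restr (A j) y))"
      using Suc.IH[OF restr_in_c00[OF Suc.prems(1)] restr_in_c00[OF Suc.prems(2)]]
      by (auto intro!: sum_mono)
    also have "\<dots> \<le> 2 * (tsirelson_iter (Suc n) x + tsirelson_iter (Suc n) y)"
      unfolding sum.distrib distrib_left
      by (intro add_mono admissible_sum_le_iter_Suc Suc.prems that)
    finally show ?thesis .
  qed
  from SUP_admissible_le[of n "\<lambda>i. x i + y i", OF this] Suc.IH[OF Suc.prems] show ?case
    by (auto simp: max_def)
qed

lemma tsirelson_iter_scale_le:
  "x \<in> c00 \<Longrightarrow> tsirelson_iter n (\<lambda>i. c * x i) \<le> cmod c * tsirelson_iter n x"
proof (induction n arbitrary: x)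
  case 0
  have "(SUP j. cmod (c * x j)) \<le> cmod c * (SUP j. cmod (x j))"
    unfolding norm_mult using 0
    by (intro cSUP_least mult_left_mono cSUP_upper bdd_above_cmod_c00) auto
  then show ?case by simp
next
  case (Suc n)
  have "admissible_sum n (\<lambda>i. c * x i) (k, A) \<le> 2 * (cmod c * tsirelson_iter (Suc n) x)"
    if "admissible k A" for k A
  proof -
    have "restr (A j) (\<lambda>i. c * x i) = (\<lambda>i. c * restr (A j) x i)" for j
      by (auto simp: restr_def)
    then have "admissible_sum n (\<lambda>i. c * x i) (k, A)
        \<le> (\<Sum>j<k. cmod c * tsirelson_iter n (restr (A j) x))"
      using Suc.IH[OF restr_in_c00[OF Suc.prems]] by (auto intro!: sum_mono)
    also have "\<dots> \<le> cmod c * (2 * tsirelson_iter (Suc n) x)"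
      unfolding sum_distrib_left[symmetric]
      by (intro mult_left_mono admissible_sum_le_iter_Suc[OF Suc.prems that]) auto
    finally show ?thesis by simp
  qed
  from SUP_admissible_le[of n "\<lambda>i. c * x i", OF this]
  have 1: "1/2 * (SUP (k, A) \<in> {(k, A). admissible k A}.
        \<Sum>j<k. tsirelson_iter n (restr (A j) (\<lambda>i. c * x i))) \<le> cmod c * tsirelson_iter (Suc n) x"
    by linarith
  have "tsirelson_iter n (\<lambda>i. c * x i) \<le> cmod c * tsirelson_iter n x"
    by (rule Suc.IH[OF Suc.prems])
  also have "\<dots> \<le> cmod c * tsirelson_iter (Suc n) x"
    by (intro mult_left_mono) auto
  finally show ?case using 1 by (simp only: tsirelson_iter.simps(2) max.bounded_iff)
qed

text \<open>The iterates increase and stay below \<open>l1_norm x\<close>, so \<open>lim\<close>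
  denotes a genuine limit.\<close>

lemma tsirelson_iter_tendsto:
  assumes "x \<in> c00"
  shows "(\<lambda>n. tsirelson_iter n x) \<longlonglongrightarrow> tsirelson_norm x"
proof -
  have "incseq (\<lambda>n. tsirelson_iter n x)" by (rule incseq_SucI) simp
  moreover have "bdd_above (range (\<lambda>n. tsirelson_iter n x))"
    using tsirelson_iter_bounds[OF assms] by (intro bdd_aboveI2) auto
  ultimately have "convergent (\<lambda>n. tsirelson_iter n x)"
    using LIMSEQ_incseq_SUP convergent_def by blast
  then show ?thesis unfolding tsirelson_norm_def by (simp add: convergent_LIMSEQ_iff)
qed

lemma tsirelson_norm_ge:
  assumes "x \<in> c00"
  shows "cmod (x j) \<le> tsirelson_norm x"
proof -
  have "cmod (x j) \<le> tsirelson_iter 0 x"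
    using cSUP_upper[OF UNIV_I bdd_above_cmod_c00[OF assms]] by simp
  also have "\<dots> \<le> tsirelson_norm x"
    by (rule incseq_le[OF incseq_SucI tsirelson_iter_tendsto[OF assms]]) simp
  finally show ?thesis .
qed

lemma tsirelson_norm_nonneg: "x \<in> c00 \<Longrightarrow> 0 \<le> tsirelson_norm x"
  using tsirelson_norm_ge norm_ge_zero order_trans by blast

lemma tsirelson_norm_triangle:
  assumes "x \<in> c00" "y \<in> c00"
  shows "tsirelson_norm (\<lambda>i. x i + y i) \<le> tsirelson_norm x + tsirelson_norm y"
  by (rule LIMSEQ_le[OF tsirelson_iter_tendsto[OF c00_add[OF assms]]
        tendsto_add[OF tsirelson_iter_tendsto[OF assms(1)] tsirelson_iter_tendsto[OF assms(2)]]])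
    (use tsirelson_iter_triangle[OF assms] in blast)

lemma tsirelson_norm_scale_le:
  assumes "x \<in> c00"
  shows "tsirelson_norm (\<lambda>i. c * x i) \<le> cmod c * tsirelson_norm x"
  by (rule LIMSEQ_le[OF tsirelson_iter_tendsto[OF c00_scale[OF assms]]
        tendsto_mult[OF tendsto_const tsirelson_iter_tendsto[OF assms]]])
    (use tsirelson_iter_scale_le[OF assms] in blast)

lemma tsirelson_norm_sum_le:
  assumes "finite J" "\<And>j. j \<in> J \<Longrightarrow> f j \<in> c00"
  shows "tsirelson_norm (\<lambda>i. \<Sum>j\<in>J. f j i) \<le> (\<Sum>j\<in>J. tsirelson_norm (f j))"
  using assms
proof (induction J rule: finite_induct)
  case empty
  \<comment> \<open>The empty sum is the zero vector, whose norm is bounded by 0 through scaling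
    with the factor 0.\<close>
  have "tsirelson_norm (\<lambda>i. 0 * (0::complex)) \<le> cmod 0 * tsirelson_norm (\<lambda>i. 0)"
    by (rule tsirelson_norm_scale_le) (simp add: c00_def supp_def)
  then show ?case by simp
next
  case (insert j J)
  have "tsirelson_norm (\<lambda>i. f j i + (\<Sum>j\<in>J. f j i))
      \<le> tsirelson_norm (f j) + tsirelson_norm (\<lambda>i. \<Sum>j\<in>J. f j i)"
    using insert by (intro tsirelson_norm_triangle c00_sum) auto
  then show ?case using insert by fastforce
qed

text \<open>The limit of \<open>admissible_sum_le_iter_Suc\<close>. This is the characteristic
  property of Tsirelson's norm: on \<open>k\<close> successive sets beyond \<open>k\<close> it
  controls the l1 sum of the pieces up to the factor 2.\<close>

lemma sum_tsirelson_norm_restr_le: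
  assumes "x \<in> c00" "admissible k A"
  shows "(\<Sum>j<k. tsirelson_norm (restr (A j) x)) \<le> 2 * tsirelson_norm x"
proof (rule LIMSEQ_le)
  show "(\<lambda>n. \<Sum>j<k. tsirelson_iter n (restr (A j) x)) \<longlonglongrightarrow> (\<Sum>j<k. tsirelson_norm (restr (A j) x))"
    by (intro tendsto_sum tsirelson_iter_tendsto restr_in_c00 assms)
  show "(\<lambda>n. 2 * tsirelson_iter (Suc n) x) \<longlonglongrightarrow> 2 * tsirelson_norm x"
    by (intro tendsto_mult tendsto_const LIMSEQ_Suc tsirelson_iter_tendsto assms)
qed (use admissible_sum_le_iter_Suc[OF assms] in blast)

section \<open>The 2-convexification, duality and 2-estimates\<close>

abbreviation cmod_sq :: "(nat \<Rightarrow> complex) \<Rightarrow> nat \<Rightarrow> complex" where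
  "cmod_sq x \<equiv> \<lambda>j. of_real ((cmod (x j))\<^sup>2)"

lemma cmod_sq_c00: "x \<in> c00 \<Longrightarrow> cmod_sq x \<in> c00"
  by (simp add: c00_def supp_def)

lemma T2_norm_square: "x \<in> c00 \<Longrightarrow> (T2_norm x)\<^sup>2 = tsirelson_norm (cmod_sq x)"
  unfolding T2_norm_def using tsirelson_norm_nonneg[OF cmod_sq_c00] by simp

lemma T2_norm_nonneg: "x \<in> c00 \<Longrightarrow> 0 \<le> T2_norm x"
  unfolding T2_norm_def using tsirelson_norm_nonneg[OF cmod_sq_c00] by simp

lemma cmod_le_T2_norm: "x \<in> c00 \<Longrightarrow> cmod (x j) \<le> T2_norm x"
  unfolding T2_norm_def using tsirelson_norm_ge[OF cmod_sq_c00, of x j]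
  by (intro real_le_rsqrt) (simp add: norm_power)

lemma T2_norm_scale_le:
  assumes "x \<in> c00"
  shows "T2_norm (\<lambda>i. c * x i) \<le> cmod c * T2_norm x"
proof -
  have "tsirelson_norm (cmod_sq (\<lambda>i. c * x i)) = tsirelson_norm (\<lambda>i. of_real ((cmod c)\<^sup>2) * cmod_sq x i)"
    by (simp add: norm_mult power_mult_distrib)
  also have "\<dots> \<le> (cmod c)\<^sup>2 * tsirelson_norm (cmod_sq x)"
    using tsirelson_norm_scale_le[OF cmod_sq_c00[OF assms], of "of_real ((cmod c)\<^sup>2)"]
    by (simp add: norm_power)
  also have "\<dots> = (cmod c * T2_norm x)\<^sup>2"
    by (simp add: power_mult_distrib T2_norm_square[OF assms])
  finally show ?thesis
    unfolding T2_norm_def[of "\<lambda>i. c * x i"] using T2_norm_nonneg[OF assms]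
    by (intro real_le_lsqrt) auto
qed

text \<open>Unconditionality with constant 1; it allows phases to be changed freely in the duality
  argument.\<close>

lemma T2_norm_cong_cmod: "(\<And>i. cmod (x i) = cmod (y i)) \<Longrightarrow> T2_norm x = T2_norm y"
  by (simp add: T2_norm_def)

text \<open>Truncations of a finitely supported vector are eventually the vector itself. The bounds
  in a Lozanovskii factorization, stated with \<open>X_norm\<close>, thereby become bounds on
  \<open>T2_norm\<close>.\<close>

lemma X_norm_c00:
  assumes "x \<in> c00"
  shows "X_norm N x = N x"
proof -
  from assms obtain m where m: "\<And>i. x i \<noteq> 0 \<Longrightarrow> i < m"
    by (auto simp: c00_def supp_def finite_nat_set_iff_bounded)
  have "restr {..<n} x = x" if "n \<ge> m" for n
    using m that by (force simp: restr_def)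
  then have "(\<lambda>n. N (restr {..<n} x)) \<longlonglongrightarrow> N x"
    by (intro tendsto_eventually eventually_sequentiallyI[of m]) simp
  then show ?thesis unfolding X_norm_def by (rule limI)
qed

text \<open>The vector \<open>x\<close> is normalized and its phases are turned so that all products
  with \<open>w\<close> are nonnegative; the functional bound for this test vector has the sum of
  moduli on its left side.\<close>

lemma T2_dual_pairing:
  assumes w: "w \<in> c00" "dual_norm T2_norm w \<le> 1" and x: "x \<in> c00"
  shows "(\<Sum>i\<in>supp w. cmod (x i) * cmod (w i)) \<le> T2_norm x"
proof (cases "T2_norm x = 0")
  case True
  then have "x i = 0" for i using cmod_le_T2_norm[OF x, of i] by simp
  then show ?thesis using True by simp
next
  case False
  define t where "t = T2_norm x"
  have t: "t > 0" using False T2_norm_nonneg[OF x] by (simp add: t_def)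
  have finw: "finite (supp w)" and finx: "finite (supp x)" using w x by (auto simp: c00_def)
  \<comment> \<open>A real supremum says nothing about unbounded sets. Coordinates in the unit ball
    are at most 1, so the values stay below \<open>l1_norm w\<close>.\<close>
  have bdd: "bdd_above (dual_values T2_norm w)"
  proof (rule bdd_aboveI)
    fix r assume "r \<in> dual_values T2_norm w"
    then obtain z where z: "z \<in> c00" "T2_norm z \<le> 1" and r: "r = cmod (\<Sum>j\<in>supp z. z j * w j)"
      by (auto simp: dual_values_def)
    have finz: "finite (supp z)" using z by (simp add: c00_def)
    have "r \<le> (\<Sum>j\<in>supp z. cmod (z j) * cmod (w j))"
      unfolding r norm_mult[symmetric] by (rule norm_sum)
    also have "\<dots> \<le> (\<Sum>j\<in>supp z. cmod (w j))"
      using order_trans[OF cmod_le_T2_norm[OF z(1)] z(2)]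
      by (intro sum_mono mult_left_le_one_le) auto
    also have "\<dots> \<le> (\<Sum>j\<in>supp z \<union> supp w. cmod (w j))"
      using finz finw by (intro sum_mono2) auto
    also have "\<dots> = l1_norm w" using finz finw by (intro l1_norm_eq[symmetric]) auto
    finally show "r \<le> l1_norm w" .
  qed
  \<comment> \<open>The phase 1 where \<open>w\<close> vanishes keeps the support of
    \<open>y\<close> equal to that of \<open>x\<close>.\<close>
  define y where "y i = (of_real (1/t) :: complex) * (of_real (cmod (x i)) * (if w i = 0 then 1 else cnj (sgn (w i))))"
    for i
  have cm: "cmod (of_real (cmod (x i)) * (if w i = 0 then 1 else cnj (sgn (w i)))) = cmod (x i)" for i
    by (simp add: norm_mult norm_sgn)
  let ?x' = "\<lambda>i. of_real (cmod (x i)) * (if w i = 0 then 1 else cnj (sgn (w i)))"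
  have x': "?x' \<in> c00" using x cm unfolding c00_def supp_def
    by (auto elim!: finite_subset[rotated])
  have yc: "y \<in> c00" unfolding y_def by (rule c00_scale[OF x'])
  have "T2_norm y \<le> cmod (of_real (1/t)) * T2_norm ?x'"
    unfolding y_def by (rule T2_norm_scale_le[OF x'])
  also have "T2_norm ?x' = t" unfolding t_def by (rule T2_norm_cong_cmod[OF cm])
  finally have yn: "T2_norm y \<le> 1" using t by (simp add: norm_divide)
  have "cmod (\<Sum>j\<in>supp y. y j * w j) \<le> dual_norm T2_norm w"
    unfolding dual_norm_def using yc yn by (intro cSup_upper bdd) (auto simp: dual_values_def)
  then have le: "cmod (\<Sum>j\<in>supp y. y j * w j) \<le> 1" using w by simp
  have yw: "y j * w j = of_real (cmod (x j) * cmod (w j) / t)" for j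
  proof -
    have "cnj (sgn (w j)) * w j = of_real (cmod (w j))"
    proof (cases "w j = 0")
      case False
      have "cnj (w j) * w j = of_real ((cmod (w j))\<^sup>2)"
        by (metis complex_norm_square mult.commute)
      then show ?thesis using False by (simp add: sgn_eq power2_eq_square)
    qed simp
    then show ?thesis by (cases "w j = 0") (auto simp: y_def)
  qed
  have "(\<Sum>j\<in>supp w. cmod (x j) * cmod (w j) / t) = (\<Sum>j\<in>supp x \<union> supp w. cmod (x j) * cmod (w j) / t)"
    using finx finw by (intro sum.mono_neutral_left) (auto simp: supp_def)
  also have "\<dots> = (\<Sum>j\<in>supp x. cmod (x j) * cmod (w j) / t)"
    using finx finw by (intro sum.mono_neutral_right) (auto simp: supp_def)
  also have "supp x = supp y" using t by (auto simp: supp_def y_def sgn_eq)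
  also have "(\<Sum>j\<in>supp y. cmod (x j) * cmod (w j) / t) = cmod (\<Sum>j\<in>supp y. y j * w j)"
    unfolding yw of_real_sum[symmetric] norm_of_real
    by (intro abs_of_nonneg[symmetric] sum_nonneg) (use t in auto)
  finally have "(\<Sum>j\<in>supp w. cmod (x j) * cmod (w j)) / t \<le> 1"
    using le by (simp add: sum_divide_distrib)
  then show ?thesis using t by (simp add: t_def field_simps)
qed

lemma disjoint_sum_eq_single:
  fixes f :: "'a \<Rightarrow> 'b::comm_monoid_add"
  assumes "finite J" "j \<in> J" "\<And>k. k \<in> J \<Longrightarrow> k \<noteq> j \<Longrightarrow> f k = 0"
  shows "(\<Sum>k\<in>J. f k) = f j"
  using assms by (simp add: sum.remove[of J j])

text \<open>At each coordinate at most one summand differs from 0, so no cross terms arise.\<close>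

lemma cmod_disjoint_sum_square:
  assumes "finite J" "disjoint_family_on (\<lambda>j. supp (U j)) J"
  shows "(cmod (\<Sum>j\<in>J. b j * U j i))\<^sup>2 = (\<Sum>j\<in>J. (cmod (b j))\<^sup>2 * (cmod (U j i))\<^sup>2)"
proof (cases "\<exists>j\<in>J. U j i \<noteq> 0")
  case True
  then obtain j where j: "j \<in> J" "U j i \<noteq> 0" by blast
  then have 0: "U k i = 0" if "k \<in> J" "k \<noteq> j" for k
    using assms that by (auto simp: disjoint_family_on_def supp_def)
  have "(\<Sum>k\<in>J. b k * U k i) = b j * U j i"
    using assms j 0 by (intro disjoint_sum_eq_single) auto
  moreover have "(\<Sum>k\<in>J. (cmod (b k))\<^sup>2 * (cmod (U k i))\<^sup>2) = (cmod (b j))\<^sup>2 * (cmod (U j i))\<^sup>2"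
    using assms j 0 by (intro disjoint_sum_eq_single) auto
  ultimately show ?thesis by (simp add: norm_mult power_mult_distrib)
qed (auto simp: assms)

lemma l2_norm_disjoint_sum:
  assumes "finite J" "disjoint_family_on (\<lambda>j. supp (U j)) J"
    and "\<And>j. j \<in> J \<Longrightarrow> U j \<in> c00 \<and> l2_norm (U j) = 1"
  shows "l2_norm (\<lambda>i. \<Sum>j\<in>J. b j * U j i) = L2_set (\<lambda>j. cmod (b j)) J"
proof -
  have s: "(\<lambda>i. (cmod (U j i))\<^sup>2) sums 1" if "j \<in> J" for j
  proof -
    have "U j \<in> ell2" using assms(3)[OF that] c00_subset_ell2 by blast
    moreover have "(\<Sum>i. (cmod (U j i))\<^sup>2) = 1"
      using assms(3)[OF that] by (simp add: l2_norm_def)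
    ultimately show ?thesis by (simp add: ell2_def sums_iff)
  qed
  have "(\<lambda>i. \<Sum>j\<in>J. (cmod (b j))\<^sup>2 * (cmod (U j i))\<^sup>2) sums (\<Sum>j\<in>J. (cmod (b j))\<^sup>2 * 1)"
    by (intro sums_sum sums_mult s)
  then show ?thesis
    unfolding l2_norm_def L2_set_def cmod_disjoint_sum_square[OF assms(1,2)]
    by (simp add: sums_iff)
qed

text \<open>Squared moduli of disjoint vectors add, so the triangle inequality of Tsirelson's norm
  becomes an upper 2-estimate with constant 1.\<close>

lemma T2_norm_disjoint_sum_le:
  assumes "finite J" "disjoint_family_on (\<lambda>j. supp (V j)) J"
    and "\<And>j. j \<in> J \<Longrightarrow> V j \<in> c00 \<and> T2_norm (V j) \<le> 1"
  shows "T2_norm (\<lambda>i. \<Sum>j\<in>J. b j * V j i) \<le> L2_set (\<lambda>j. cmod (b j)) J"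
proof -
  let ?f = "\<lambda>j i. (of_real ((cmod (b j))\<^sup>2) :: complex) * cmod_sq (V j) i"
  have "cmod_sq (\<lambda>i. \<Sum>j\<in>J. b j * V j i) = (\<lambda>i. \<Sum>j\<in>J. ?f j i)"
    unfolding cmod_disjoint_sum_square[OF assms(1,2)] by simp
  then have "tsirelson_norm (cmod_sq (\<lambda>i. \<Sum>j\<in>J. b j * V j i)) = tsirelson_norm (\<lambda>i. \<Sum>j\<in>J. ?f j i)"
    by simp
  also have "\<dots> \<le> (\<Sum>j\<in>J. tsirelson_norm (?f j))"
    using assms by (intro tsirelson_norm_sum_le c00_scale cmod_sq_c00) auto
  also have "\<dots> \<le> (\<Sum>j\<in>J. (cmod (b j))\<^sup>2)"
  proof (rule sum_mono)
    fix j assume j: "j \<in> J"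
    have V: "V j \<in> c00" "T2_norm (V j) \<le> 1" using assms(3)[OF j] by auto
    have "tsirelson_norm (?f j) \<le> (cmod (b j))\<^sup>2 * (T2_norm (V j))\<^sup>2"
      using tsirelson_norm_scale_le[OF cmod_sq_c00[OF V(1)], of "of_real ((cmod (b j))\<^sup>2)"]
      by (simp add: T2_norm_square[OF V(1)] norm_power)
    also have "\<dots> \<le> (cmod (b j))\<^sup>2 * 1"
      using V T2_norm_nonneg by (intro mult_left_mono) (auto simp: power_le_one)
    finally show "tsirelson_norm (?f j) \<le> (cmod (b j))\<^sup>2" by simp
  qed
  finally show ?thesis
    unfolding T2_norm_def[of "\<lambda>i. \<Sum>j\<in>J. b j * V j i"] L2_set_def by (rule real_sqrt_le_mono)
qed

text \<open>The lower 2-estimate on admissible families: squaring moduli commutes with restriction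
  and reduces it to \<open>sum_tsirelson_norm_restr_le\<close>.\<close>

lemma T2_norm_restr_sum_le:
  assumes "x \<in> c00" "admissible k A"
  shows "(\<Sum>j<k. (T2_norm (restr (A j) x))\<^sup>2) \<le> 2 * (T2_norm x)\<^sup>2"
proof -
  have "(T2_norm (restr (A j) x))\<^sup>2 = tsirelson_norm (restr (A j) (cmod_sq x))" for j
  proof -
    have "cmod_sq (restr (A j) x) = restr (A j) (cmod_sq x)" by (auto simp: restr_def)
    then show ?thesis using T2_norm_square[OF restr_in_c00[OF assms(1)], of "A j"] by simp
  qed
  then show ?thesis
    using sum_tsirelson_norm_restr_le[OF cmod_sq_c00[OF assms(1)] assms(2)]
      T2_norm_square[OF assms(1)] by simp
qed


subsection \<open>The centralizer on blocks\<close>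

lemma half_in_interior_strip: "1/2 \<in> interior strip"
proof -
  have "open {z. 0 < Re z \<and> Re z < 1}"
    by (intro open_Collect_conj open_halfspace_Re_gt open_halfspace_Re_lt)
  moreover have "{z. 0 < Re z \<and> Re z < 1} \<subseteq> strip" by (auto simp: strip_def)
  ultimately show ?thesis by (intro interiorI[of "{z. 0 < Re z \<and> Re z < 1}"]) auto
qed

text \<open>The selection is prescribed on the strip only; since 1/2 is an interior point, this
  already fixes the derivative there.\<close>

lemma deriv_half_cong:
  assumes "\<And>z. z \<in> strip \<Longrightarrow> f z = g z"
  shows "deriv f (1/2) = deriv g (1/2)"
proof (rule deriv_cong_ev)
  have "eventually (\<lambda>z. z \<in> interior strip) (nhds (1/2))"
    by (rule eventually_nhds_in_open[OF open_interior half_in_interior_strip])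
  then show "\<forall>\<^sub>F z in nhds (1/2). f z = g z"
    by eventually_elim (use assms interior_subset in blast)
qed simp

text \<open>Both powers equal 1 at \<open>z = 1/2\<close>, so the product rule leaves
  \<open>c\<close> times the difference \<open>ln r - ln p\<close>.\<close>

lemma deriv_powr_factors:
  fixes p r :: real and c :: complex
  assumes "0 < p" "0 < r"
  shows "deriv (\<lambda>z. c * of_real p powr (1/2 - z) * of_real r powr (z - 1/2)) (1/2)
    = c * of_real (ln (r / p))"
proof (rule DERIV_imp_deriv)
  show "((\<lambda>z. c * of_real p powr (1/2 - z) * of_real r powr (z - 1/2))
      has_field_derivative c * of_real (ln (r / p))) (at (1/2))"
    unfolding powr_def using assms
    by (auto intro!: derivative_eq_intros simp: Ln_of_real ln_div algebra_simps)
qed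

text \<open>The factorization is that of the unit vector \<open>u\<close>, and homogeneity of
  \<open>B\<close> carries the factor \<open>c\<close>. One pair \<open>v\<close>, \<open>w\<close>
  therefore serves all multiples of \<open>u\<close>; \<open>c = 1\<close> gives the centralizer at
  \<open>u\<close> itself.\<close>

lemma centralizer_scaled:
  assumes B: "lozanovskii_selection N B" and u: "u \<in> c00" "l2_norm u = 1"
  obtains v w where "lozanovskii_factorization N u v w"
    "\<And>c i. centralizer B (\<lambda>i. c * u i) i = c * u i * of_real (ln (cmod (w i) / cmod (v i)))"
proof -
  from B u obtain v w where L: "lozanovskii_factorization N u v w"
    and Bu: "\<And>z j. z \<in> strip \<Longrightarrow> B u z j =
      u j * of_real (cmod (v j)) powr (1/2 - z) * of_real (cmod (w j)) powr (z - 1/2)"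
    unfolding lozanovskii_selection_def by blast
  have u2: "u \<in> ell2" using u c00_subset_ell2 by blast
  have "centralizer B (\<lambda>i. c * u i) i = c * u i * of_real (ln (cmod (w i) / cmod (v i)))" for c i
  proof -
    let ?g = "\<lambda>z. (c * u i) * of_real (cmod (v i)) powr (1/2 - z) * of_real (cmod (w i)) powr (z - 1/2)"
    have "B (\<lambda>i. c * u i) z i = ?g z" if "z \<in> strip" for z
    proof -
      have "B (\<lambda>i. c * u i) z i = c * B u z i"
        using B u2 that unfolding lozanovskii_selection_def homogeneous_selection_def by blast
      then show ?thesis using Bu[OF that] by simp
    qed
    then have eq: "centralizer B (\<lambda>i. c * u i) i = deriv ?g (1/2)"
      unfolding centralizer_def by (rule deriv_half_cong)
    show ?thesis
    \<comment> \<open>Where \<open>u i = 0\<close> the factors vanish too and their quotient is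
      meaningless, but both sides carry the factor 0.\<close>
    proof (cases "u i = 0")
      case False
      with L have "0 < cmod (v i)" "0 < cmod (w i)"
        by (auto simp: lozanovskii_factorization_def supp_def)
      then show ?thesis unfolding eq by (rule deriv_powr_factors)
    qed (simp add: eq)
  qed
  with L show ?thesis by (rule that)
qed

section \<open>Comparison of factorizations\<close>

text \<open>The quadratic Taylor bound gives \<open>s\<^sup>2 \<le> 2 * exp s\<close> for
  \<open>s = \<bar>ln t\<bar>\<close>, and \<open>exp s\<close> is \<open>t\<close> or
  \<open>1 / t\<close>.\<close>

lemma ln_square_le:
  assumes "0 < (t::real)"
  shows "(ln t)\<^sup>2 \<le> 2 * (t + 1 / t)"
proof -
  have *: "s\<^sup>2 \<le> 2 * exp s" if "0 \<le> s" for s :: real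
    using exp_lower_Taylor_quadratic[OF that] that by linarith
  show ?thesis
  proof (cases "1 \<le> t")
    case True
    then have "(ln t)\<^sup>2 \<le> 2 * t" using *[of "ln t"] assms by simp
    also have "\<dots> \<le> 2 * (t + 1 / t)" using assms by simp
    finally show ?thesis .
  next
    case False
    then have "(ln t)\<^sup>2 \<le> 2 * (1 / t)"
      using *[of "- ln t"] assms by (simp add: exp_minus inverse_eq_divide)
    also have "\<dots> \<le> 2 * (t + 1 / t)" using assms by simp
    finally show ?thesis .
  qed
qed

text \<open>
  With \<open>t = v / p = r / w\<close> the difference of the logarithms is \<open>2 * ln t\<close>, while \<open>v * r\<close> and \<open>p * w\<close>
  are \<open>t\<close> and \<open>1 / t\<close> times the common product.
\<close>

lemma factorization_log_difference:
  fixes p r v w :: real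
  assumes "0 < p" "0 < r" "0 < v" "0 < w" "p * r = v * w"
  shows "p * r * (ln (r / p) - ln (w / v))\<^sup>2 \<le> 8 * (v * r + p * w)"
proof -
  define t where "t = v / p"
  have t: "t > 0" using assms by (simp add: t_def)
  have v: "v = t * p" using assms by (simp add: t_def)
  have r: "r = t * w" using assms by (simp add: t_def field_simps)
  have "ln (r / p) - ln (w / v) = 2 * ln t"
    using assms t by (simp add: ln_div) (simp add: v r ln_mult)
  then have "p * r * (ln (r / p) - ln (w / v))\<^sup>2 = 4 * (p * r) * (ln t)\<^sup>2"
    by (simp add: power2_eq_square)
  also have "\<dots> \<le> 4 * (p * r) * (2 * (t + 1 / t))"
    using assms t by (intro mult_left_mono ln_square_le) auto
  also have "\<dots> = 8 * (v * r + p * w)"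
    using t by (simp add: v r field_simps)
  finally show ?thesis .
qed

text \<open>
  If \<open>(v\<^sub>j, w\<^sub>j)\<close> factorizes \<open>u\<^sub>j\<close>, then \<open>(\<Sum> b\<^sub>j v\<^sub>j, \<Sum> b\<^sub>j w\<^sub>j)\<close> factorizes \<open>\<Sum> b\<^sub>j u\<^sub>j\<close> up to the
  constant of the lower 2-estimate of \<open>\<T>\<^sup>2\<close> on admissible blocks.
\<close>

lemma centralizer_unit_combination:
  assumes B: "lozanovskii_selection T2_norm B"
    and U: "\<And>j. j < n \<Longrightarrow> U j \<in> c00 \<and> l2_norm (U j) = 1"
    and adm: "admissible n (\<lambda>j. supp (U j))"
    and b: "L2_set (\<lambda>j. cmod (b j)) {..<n} = 1"
  shows "l2_norm (\<lambda>i. (\<Sum>j<n. b j * centralizer B (U j) i) - centralizer B (\<lambda>i. \<Sum>j<n. b j * U j i) i) \<le> 5"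
proof -
  let ?O = "centralizer B"
  have "\<forall>j. \<exists>v w. j < n \<longrightarrow> lozanovskii_factorization T2_norm (U j) v w \<and>
      (\<forall>i. ?O (U j) i = U j i * of_real (ln (cmod (w i) / cmod (v i))))"
  proof
    fix j
    show "\<exists>v w. j < n \<longrightarrow> lozanovskii_factorization T2_norm (U j) v w \<and>
      (\<forall>i. ?O (U j) i = U j i * of_real (ln (cmod (w i) / cmod (v i))))"
    proof (cases "j < n")
      case True
      with U have "U j \<in> c00" "l2_norm (U j) = 1" by auto
      from centralizer_scaled[OF B this] obtain v w where
        "lozanovskii_factorization T2_norm (U j) v w"
        "\<And>c i. ?O (\<lambda>i. c * U j i) i = c * U j i * of_real (ln (cmod (w i) / cmod (v i)))" by metis
      from this(1) this(2)[of 1] show ?thesis by auto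
    qed auto
  qed
  then obtain V W where L: "\<And>j. j < n \<Longrightarrow> lozanovskii_factorization T2_norm (U j) (V j) (W j)"
    and OU: "\<And>j i. j < n \<Longrightarrow> ?O (U j) i = U j i * of_real (ln (cmod (W j i) / cmod (V j i)))"
    by metis
  have disj: "disjoint_family_on (\<lambda>j. supp (U j)) {..<n}" by (rule admissible_disjoint[OF adm])
  have suppV: "supp (V j) = supp (U j)" and suppW: "supp (W j) = supp (U j)"
    and dualW: "dual_norm T2_norm (W j) \<le> 1"
    and fact: "(cmod (U j i))\<^sup>2 = cmod (V j i) * cmod (W j i)" if "j < n" for j i
    using L[OF that] by (auto simp: lozanovskii_factorization_def)
  have Vc: "V j \<in> c00" and Wc: "W j \<in> c00" if "j < n" for j
    using U[OF that] suppV[OF that] suppW[OF that] by (auto simp: c00_def)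
  have VT: "T2_norm (V j) \<le> 1" if "j < n" for j
    using L[OF that] X_norm_c00[OF Vc[OF that], of T2_norm]
    by (simp add: lozanovskii_factorization_def)
  define u where "u i = (\<Sum>j<n. b j * U j i)" for i
  define p where "p i = (\<Sum>j<n. b j * V j i)" for i
  define r where "r i = (\<Sum>j<n. b j * W j i)" for i
  have uc: "u \<in> c00" unfolding u_def using U by (intro c00_sum c00_scale) auto
  have pc: "p \<in> c00" unfolding p_def using Vc by (intro c00_sum c00_scale) auto
  have "l2_norm u = 1"
    unfolding u_def using l2_norm_disjoint_sum[OF _ disj, of b] U b by simp
  from centralizer_scaled[OF B uc this] obtain v w
    where Lu: "lozanovskii_factorization T2_norm u v w"
      and "\<And>c i. ?O (\<lambda>i. c * u i) i = c * u i * of_real (ln (cmod (w i) / cmod (v i)))" by metis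
  from this(2)[of 1] have Ou: "?O u i = u i * of_real (ln (cmod (w i) / cmod (v i)))" for i by simp
  have suppv: "supp v = supp u" and suppw: "supp w = supp u" and dualw: "dual_norm T2_norm w \<le> 1"
    and factu: "(cmod (u i))\<^sup>2 = cmod (v i) * cmod (w i)" for i
    using Lu by (auto simp: lozanovskii_factorization_def)
  have vc: "v \<in> c00" and wc: "w \<in> c00" using uc suppv suppw by (auto simp: c00_def)
  have vT: "T2_norm v \<le> 1"
    using Lu X_norm_c00[OF vc, of T2_norm] by (simp add: lozanovskii_factorization_def)
  define E where "E i = (\<Sum>j<n. b j * ?O (U j) i) - ?O u i" for i
  \<comment> \<open>On one block all the sums over \<open>j\<close> collapse to a single term,
    because \<open>V j\<close> and \<open>W j\<close> share the support of
    \<open>U j\<close>.\<close>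
  have single: "u i = b j * U j i" "p i = b j * V j i" "r i = b j * W j i"
      "(\<Sum>j<n. b j * ?O (U j) i) = b j * ?O (U j) i" if "j < n" "i \<in> supp (U j)" for i j
  proof -
    have 0: "U k i = 0" "V k i = 0" "W k i = 0" if "k \<in> {..<n}" "k \<noteq> j" for k
    proof -
      have "supp (U k) \<inter> supp (U j) = {}"
        using disj that \<open>j < n\<close> by (auto simp: disjoint_family_on_def)
      then have "i \<notin> supp (U k)" using \<open>i \<in> supp (U j)\<close> by blast
      then show "U k i = 0" "V k i = 0" "W k i = 0"
        using suppV[of k] suppW[of k] that by (auto simp: supp_def)
    qed
    show "u i = b j * U j i" "p i = b j * V j i" "r i = b j * W j i"
      unfolding u_def p_def r_def
      using 0 that by (auto intro!: disjoint_sum_eq_single)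
    show "(\<Sum>j<n. b j * ?O (U j) i) = b j * ?O (U j) i"
      using 0 that by (intro disjoint_sum_eq_single) (auto simp: OU)
  qed
  have in_block: "\<exists>j<n. i \<in> supp (U j) \<and> b j \<noteq> 0" if "u i \<noteq> 0" for i
  proof (rule ccontr)
    assume "\<not> ?thesis"
    then have "u i = 0" unfolding u_def by (intro sum.neutral) (auto simp: supp_def)
    with that show False by simp
  qed
  \<comment> \<open>Such an \<open>i\<close> may still lie in a block, but then the coefficient of
    that block is 0.\<close>
  have E0: "E i = 0" if "u i = 0" for i
  proof -
    have "(\<Sum>j<n. b j * ?O (U j) i) = 0"
    proof (cases "\<exists>j<n. i \<in> supp (U j)")
      case True
      then obtain j where j: "j < n" "i \<in> supp (U j)" by blast
      then have "b j * U j i = 0" using single(1) that by metis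
      then show ?thesis using single(4)[OF j] OU[OF j(1)] by auto
    next
      case False
      then show ?thesis by (intro sum.neutral) (auto simp: OU supp_def)
    qed
    then show ?thesis using that by (simp add: E_def Ou)
  qed
  have Ebound: "(cmod (E i))\<^sup>2 \<le> 8 * (cmod (v i) * cmod (r i) + cmod (p i) * cmod (w i))"
    if i: "i \<in> supp u" for i
  proof -
    from i in_block obtain j where j: "j < n" "i \<in> supp (U j)" and bj: "b j \<noteq> 0"
      by (auto simp: supp_def)
    have "V j i \<noteq> 0" "W j i \<noteq> 0" "v i \<noteq> 0" "w i \<noteq> 0"
      using j suppV suppW i suppv suppw by (auto simp: supp_def)
    note pos = this
    have pr: "0 < cmod (p i)" "0 < cmod (r i)" using pos bj single[OF j] by auto
    \<comment> \<open>The coefficient \<open>b j\<close> cancels in the quotient, so the block's own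
      logarithm is that of the candidate factors \<open>r\<close> and \<open>p\<close>.\<close>
    have "ln (cmod (W j i) / cmod (V j i)) = ln (cmod (r i) / cmod (p i))"
      using bj by (simp add: single[OF j] norm_mult)
    then have "E i = u i * of_real (ln (cmod (r i) / cmod (p i)) - ln (cmod (w i) / cmod (v i)))"
      using single[OF j] by (simp add: E_def Ou OU[OF j(1)] algebra_simps)
    then have "(cmod (E i))\<^sup>2
        = (cmod (u i))\<^sup>2 * (ln (cmod (r i) / cmod (p i)) - ln (cmod (w i) / cmod (v i)))\<^sup>2"
      by (simp only: norm_mult norm_of_real power_mult_distrib power2_abs)
    also have upr: "(cmod (u i))\<^sup>2 = cmod (p i) * cmod (r i)"
      using fact[OF j(1), of i] by (simp add: single[OF j] norm_mult power_mult_distrib power2_eq_square)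
    also have "cmod (p i) * cmod (r i) * (ln (cmod (r i) / cmod (p i)) - ln (cmod (w i) / cmod (v i)))\<^sup>2
        \<le> 8 * (cmod (v i) * cmod (r i) + cmod (p i) * cmod (w i))"
      using pr pos upr factu by (intro factorization_log_difference) auto
    finally show ?thesis .
  qed
  \<comment> \<open>Duality of \<open>w\<close> with \<open>p\<close>, whose norm is at most 1 by
    the upper 2-estimate.\<close>
  have pw: "(\<Sum>i\<in>supp u. cmod (p i) * cmod (w i)) \<le> 1"
  proof -
    have "(\<Sum>i\<in>supp u. cmod (p i) * cmod (w i)) \<le> T2_norm p"
      using T2_dual_pairing[OF wc dualw pc] by (simp add: suppw)
    also have "\<dots> \<le> L2_set (\<lambda>j. cmod (b j)) {..<n}"
    proof -
      have "disjoint_family_on (\<lambda>j. supp (V j)) {..<n}"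
        using disj suppV by (auto simp: disjoint_family_on_def)
      then show ?thesis unfolding p_def using Vc VT by (intro T2_norm_disjoint_sum_le) auto
    qed
    finally show ?thesis using b by simp
  qed
  \<comment> \<open>Here \<open>v\<close> is tested against each \<open>W j\<close> on its own
    block; Cauchy-Schwarz and the lower 2-estimate for the pieces of \<open>v\<close> then give the
    bound. This is where admissibility enters beyond disjointness.\<close>
  have vr: "(\<Sum>i\<in>supp u. cmod (v i) * cmod (r i)) \<le> sqrt 2"
  proof -
    let ?x = "\<lambda>j. restr (supp (U j)) v"
    have finU: "finite (supp (U j))" if "j < n" for j using U[OF that] by (simp add: c00_def)
    have "(\<Sum>i\<in>supp u. cmod (v i) * cmod (r i))
        \<le> (\<Sum>i\<in>(\<Union>j<n. supp (U j)). cmod (v i) * cmod (r i))"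
      using in_block finU by (intro sum_mono2) (auto simp: supp_def)
    also have "\<dots> = (\<Sum>j<n. \<Sum>i\<in>supp (U j). cmod (v i) * cmod (r i))"
      using finU disj by (intro sum.UNION_disjoint) (auto simp: disjoint_family_on_def)
    also have "\<dots> = (\<Sum>j<n. cmod (b j) * (\<Sum>i\<in>supp (W j). cmod (?x j i) * cmod (W j i)))"
      unfolding sum_distrib_left
      by (intro sum.cong) (auto simp: single suppW restr_def norm_mult)
    also have "\<dots> \<le> (\<Sum>j<n. cmod (b j) * T2_norm (?x j))"
      using Wc dualW restr_in_c00[OF vc] by (intro sum_mono mult_left_mono T2_dual_pairing) auto
    also have "\<dots> \<le> (\<Sum>j<n. \<bar>cmod (b j)\<bar> * \<bar>T2_norm (?x j)\<bar>)"
      by (intro sum_mono) (simp add: mult_left_mono)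
    also have "\<dots> \<le> L2_set (\<lambda>j. cmod (b j)) {..<n} * L2_set (\<lambda>j. T2_norm (?x j)) {..<n}"
      by (rule L2_set_mult_ineq)
    also have "\<dots> = sqrt (\<Sum>j<n. (T2_norm (?x j))\<^sup>2)" using b by (simp add: L2_set_def)
    also have "\<dots> \<le> sqrt 2"
    proof (rule real_sqrt_le_mono)
      have "(\<Sum>j<n. (T2_norm (?x j))\<^sup>2) \<le> 2 * (T2_norm v)\<^sup>2"
        by (rule T2_norm_restr_sum_le[OF vc adm])
      also have "\<dots> \<le> 2" using vT T2_norm_nonneg[OF vc] by (simp add: power_le_one)
      finally show "(\<Sum>j<n. (T2_norm (?x j))\<^sup>2) \<le> 2" .
    qed
    finally show ?thesis .
  qed
  have "l2_norm E = L2_set (\<lambda>i. cmod (E i)) (supp u)"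
    using E0 uc by (intro l2_norm_eq_L2_set) (auto simp: supp_def c00_def)
  also have "\<dots> \<le> 5"
  proof -
    have "(\<Sum>i\<in>supp u. (cmod (E i))\<^sup>2)
        \<le> (\<Sum>i\<in>supp u. 8 * (cmod (v i) * cmod (r i) + cmod (p i) * cmod (w i)))"
      by (rule sum_mono[OF Ebound])
    also have "\<dots> = 8 * ((\<Sum>i\<in>supp u. cmod (v i) * cmod (r i)) + (\<Sum>i\<in>supp u. cmod (p i) * cmod (w i)))"
      by (simp add: sum_distrib_left sum.distrib)
    \<comment> \<open>With \<open>sqrt 2\<close> rounded up to 2 the total is 24, and the constant 5
      comes from \<open>24 \<le> 5\<^sup>2\<close>.\<close>
    also have "\<dots> \<le> 8 * (2 + 1)"
      using pw vr sqrt2_less_2 by (intro mult_left_mono add_mono) auto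
    also have "\<dots> \<le> 5\<^sup>2" by simp
    finally show ?thesis unfolding L2_set_def by (intro real_le_lsqrt) auto
  qed
  finally show ?thesis unfolding E_def u_def .
qed

text \<open>Dividing by the norm of the coefficients reduces this to
  \<open>centralizer_unit_combination\<close>, as the error term is homogeneous in \<open>b\<close>.
  Zero coefficients are treated apart.\<close>

lemma centralizer_combination:
  fixes b :: "nat \<Rightarrow> complex"
  assumes B: "lozanovskii_selection T2_norm B"
    and U: "\<And>j. j < n \<Longrightarrow> U j \<in> c00 \<and> l2_norm (U j) = 1"
    and adm: "admissible n (\<lambda>j. supp (U j))"
  defines "E \<equiv> \<lambda>i. (\<Sum>j<n. b j * centralizer B (U j) i) - centralizer B (\<lambda>i. \<Sum>j<n. b j * U j i) i"
  shows "E \<in> c00" "l2_norm E \<le> 5 * L2_set (\<lambda>j. cmod (b j)) {..<n}"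
proof -
  let ?O = "centralizer B"
  define \<beta> where "\<beta> = L2_set (\<lambda>j. cmod (b j)) {..<n}"
  have n: "0 < n" using adm by (simp add: admissible_def)
  have disj: "disjoint_family_on (\<lambda>j. supp (U j)) {..<n}" by (rule admissible_disjoint[OF adm])
  define u where "u \<equiv> \<lambda>i. \<Sum>j<n. b j * U j i"
  have uc: "u \<in> c00" unfolding u_def using U by (intro c00_sum c00_scale) auto
  have scaled: "?O (\<lambda>i. c * x i) = (\<lambda>i. c * ?O x i)" and Oc: "?O x \<in> c00"
    if x: "x \<in> c00" "l2_norm x = 1" for c x
  proof -
    from centralizer_scaled[OF B x] obtain v w where
      O: "\<And>c i. ?O (\<lambda>i. c * x i) i = c * x i * of_real (ln (cmod (w i) / cmod (v i)))" by metis
    from O[of 1] have O1: "?O x i = x i * of_real (ln (cmod (w i) / cmod (v i)))" for i by simp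
    show "?O (\<lambda>i. c * x i) = (\<lambda>i. c * ?O x i)" using O O1 by auto
    have "supp (?O x) \<subseteq> supp x" by (auto simp: supp_def O1)
    then show "?O x \<in> c00" using x by (auto simp: c00_def intro: finite_subset)
  qed
  have OU: "?O (U j) \<in> c00" if "j < n" for j using Oc U[OF that] by blast
  have "E \<in> c00 \<and> l2_norm E \<le> 5 * \<beta>"
  proof (cases "\<beta> = 0")
    case True
    then have b0: "b j = 0" if "j < n" for j
      using that by (auto simp: \<beta>_def L2_set_eq_0_iff)
    \<comment> \<open>Zero is written as a multiple of a normalized block, so that homogeneity gives
      the value 0 of the centralizer.\<close>
    then have "u = (\<lambda>i. 0 * U 0 i)" by (auto simp: u_def)
    then have "?O u = (\<lambda>i. 0)" using scaled[of "U 0" 0] U[OF n] by simp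
    then have "E = (\<lambda>i. 0)" using b0 by (auto simp: E_def u_def)
    then show ?thesis using True by (simp add: c00_def supp_def l2_norm_def)
  next
    case False
    then have \<beta>: "0 < \<beta>" using L2_set_nonneg[of "\<lambda>j. cmod (b j)" "{..<n}"] by (simp add: \<beta>_def less_le)
    define b' where "b' j = of_real (1 / \<beta>) * b j" for j
    have "L2_set (\<lambda>j. cmod (b' j)) {..<n} = (1 / \<beta>) * \<beta>"
      unfolding b'_def norm_mult \<beta>_def
      by (subst L2_set_right_distrib) (auto simp: norm_divide)
    then have b': "L2_set (\<lambda>j. cmod (b' j)) {..<n} = 1" using \<beta> by simp
    have bb': "b j = of_real \<beta> * b' j" for j using \<beta> by (simp add: b'_def)
    define u' where "u' \<equiv> \<lambda>i. \<Sum>j<n. b' j * U j i"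
    have u'c: "u' \<in> c00" unfolding u'_def using U by (intro c00_sum c00_scale) auto
    have u'1: "l2_norm u' = 1"
      unfolding u'_def using l2_norm_disjoint_sum[OF _ disj, of b'] U b' by simp
    define E' where "E' \<equiv> \<lambda>i. (\<Sum>j<n. b' j * ?O (U j) i) - ?O u' i"
    have "u = (\<lambda>i. of_real \<beta> * u' i)"
      by (simp add: u_def u'_def bb' sum_distrib_left mult.assoc)
    then have "?O u = (\<lambda>i. of_real \<beta> * ?O u' i)" using scaled[OF u'c u'1] by simp
    moreover have "E = (\<lambda>i. (\<Sum>j<n. b j * ?O (U j) i) - ?O u i)" by (simp add: E_def u_def)
    ultimately have EE': "E = (\<lambda>i. of_real \<beta> * E' i)"
      by (simp add: E'_def bb' sum_distrib_left mult.assoc right_diff_distrib)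
    have E'c: "E' \<in> c00"
      unfolding E'_def using OU Oc[OF u'c u'1] by (intro c00_diff c00_sum c00_scale) auto
    have "l2_norm E' \<le> 5"
      unfolding E'_def u'_def by (rule centralizer_unit_combination[OF B U adm b'])
    moreover have "l2_norm E = \<beta> * l2_norm E'"
      unfolding EE' using l2_norm_scale[of E' "of_real \<beta>"] E'c c00_subset_ell2 \<beta> by auto
    ultimately show ?thesis
      using c00_scale[OF E'c] \<beta> by (simp add: EE')
  qed
  then show "E \<in> c00" "l2_norm E \<le> 5 * L2_set (\<lambda>j. cmod (b j)) {..<n}" by (auto simp: \<beta>_def)
qed

section \<open>The norm of the spreading model\<close>

text \<open>Each block starts after the previous one ends, so block \<open>j\<close> starts at index
  \<open>j\<close> or later. Choosing all blocks beyond number \<open>n\<close> therefore pushes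
  their supports beyond \<open>n\<close>.\<close>

lemma normalized_blocks_admissible:
  assumes u: "normalized_blocks u" and k: "strict_mono_on {..<n} k" "\<And>j. j < n \<Longrightarrow> n < k j"
    and n: "0 < n"
  shows "admissible n (\<lambda>j. supp (u (k j)))"
proof -
  have ne: "finite (supp (u j)) \<and> supp (u j) \<noteq> {}" for j
  proof -
    have "l2_norm (\<lambda>i. 0) = 0" by (simp add: l2_norm_def)
    then have "u j \<noteq> (\<lambda>i. 0)" using u unfolding normalized_blocks_def by (metis zero_neq_one)
    then show ?thesis using u by (auto simp: normalized_blocks_def c00_def supp_def)
  qed
  have step: "Max (supp (u j)) < Min (supp (u (Suc j)))" for j
    using u by (simp add: normalized_blocks_def)
  have lt: "Max (supp (u i)) < Min (supp (u j))" if "i < j" for i j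
    using successive_sets_less[of "Suc j" "\<lambda>j. supp (u j)" i j] ne step that by blast
  have ge: "j \<le> Min (supp (u j))" for j
  proof (induction j)
    case (Suc j)
    have "Min (supp (u j)) \<le> Max (supp (u j))" using ne[of j] by simp
    then show ?case using Suc step[of j] by linarith
  qed simp
  have "n \<le> Suc (Min (supp (u (k 0))))"
    using ge[of "k 0"] k(2)[OF n] by linarith
  moreover have "k j < k (Suc j)" if "Suc j < n" for j
    using k(1) that by (auto simp: strict_mono_on_def)
  ultimately show ?thesis
    unfolding admissible_def using ne n by (auto simp del: Max_less_iff Min_gr_iff intro!: lt)
qed

text \<open>For choices \<open>k\<close> beyond \<open>n\<close> the twisted combination has first
  component, corrected by the centralizer, equal to a copy of \<open>a\<close> plus an error of norm
  at most \<open>5 * l2_norm b\<close>. The two-sided bounds are uniform in \<open>k\<close> and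
  pass to the limit.\<close>

lemma spreading_norm_equivalent:
  assumes B: "lozanovskii_selection T2_norm B" and u: "normalized_blocks u"
    and q: "spreading_norm (centralizer B) u q" and a: "a \<in> c00" and b: "b \<in> c00"
  shows "q a b \<le> 6 * (l2_norm a + l2_norm b)" "l2_norm a + l2_norm b \<le> 7 * q a b"
proof -
  have "finite (supp a \<union> supp b)" using a b by (simp add: c00_def)
  then obtain n0 where "supp a \<union> supp b \<subseteq> {..<n0}" by (rule finite_nat_iff_bounded[THEN iffD1, elim_format]) blast
  \<comment> \<open>Positivity is arranged by enlarging \<open>n\<close>, since admissible families
    have at least one member.\<close>
  then obtain n where n: "0 < n" and supp: "supp a \<subseteq> {..<n}" "supp b \<subseteq> {..<n}"
    using that[of "Suc n0"] by force
  let ?O = "centralizer B"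
  let ?Z = "\<lambda>k. Z_norm ?O (twisted_combination ?O u n a b k)"
  have lim: "(?Z \<longlongrightarrow> q a b) (spreading_filter n)"
    using q supp unfolding spreading_norm_def by blast
  have na: "l2_norm a = L2_set (\<lambda>j. cmod (a j)) {..<n}"
    and nb: "l2_norm b = L2_set (\<lambda>j. cmod (b j)) {..<n}"
    using supp by (auto intro!: l2_norm_eq_L2_set)
  have bounds: "?Z k \<le> 6 * (l2_norm a + l2_norm b) \<and> l2_norm a + l2_norm b \<le> 7 * ?Z k"
    if k: "strict_mono_on {..<n} k" "\<forall>j<n. n < k j" for k
  proof -
    let ?U = "\<lambda>j. u (k j)"
    have U: "?U j \<in> c00 \<and> l2_norm (?U j) = 1" for j
      using u by (auto simp: normalized_blocks_def)
    have adm: "admissible n (\<lambda>j. supp (?U j))"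
      using normalized_blocks_admissible[OF u k(1) _ n] k(2) by blast
    define A where "A \<equiv> \<lambda>i. \<Sum>j<n. a j * ?U j i"
    define v where "v \<equiv> \<lambda>i. \<Sum>j<n. b j * ?U j i"
    define E where "E \<equiv> \<lambda>i. (\<Sum>j<n. b j * ?O (?U j) i) - ?O v i"
    have disj: "disjoint_family_on (\<lambda>j. supp (?U j)) {..<n}" by (rule admissible_disjoint[OF adm])
    have A: "l2_norm A = l2_norm a" and v: "l2_norm v = l2_norm b"
      unfolding A_def v_def na nb using U by (auto intro!: l2_norm_disjoint_sum disj)
    have Ec: "E \<in> c00" and El: "l2_norm E \<le> 5 * l2_norm b"
      unfolding E_def v_def nb
      using centralizer_combination[where n = n and U = ?U and b = b, OF B U adm] by auto
    have A2: "A \<in> ell2" and E2: "E \<in> ell2"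
      using c00_subset_ell2 Ec c00_sum[of "{..<n}" "\<lambda>j i. a j * ?U j i"] c00_scale U
      by (auto simp: A_def)
    have Z: "?Z k = l2_norm (\<lambda>i. A i + E i) + l2_norm b"
      unfolding Z_norm_def twisted_combination_def
      by (simp add: v[symmetric] A_def E_def v_def add_diff_eq)
    have 1: "l2_norm (\<lambda>i. A i + E i) \<le> l2_norm a + 5 * l2_norm b"
      using l2_norm_triangle[OF A2 E2] A El by linarith
    have 2: "l2_norm a \<le> l2_norm (\<lambda>i. A i + E i) + 5 * l2_norm b"
      using l2_norm_diff_triangle[OF ell2_add[OF A2 E2] E2] A El by simp
    have "0 \<le> l2_norm a" "0 \<le> l2_norm b" "0 \<le> l2_norm (\<lambda>i. A i + E i)"
      using a b c00_subset_ell2 A2 E2 by (auto intro!: l2_norm_nonneg ell2_add)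
    \<comment> \<open>The error constant 5 plus one more \<open>l2_norm b\<close> gives 6 in both
      directions; in the lower bound it is rounded up to 7.\<close>
    then show ?thesis unfolding Z distrib_left using 1 2 by auto
  qed
  \<comment> \<open>The threshold \<open>n\<close> itself serves as the witness for the
    filter.\<close>
  then have "\<forall>\<^sub>F k in spreading_filter n. ?Z k \<le> 6 * (l2_norm a + l2_norm b) \<and> l2_norm a + l2_norm b \<le> 7 * ?Z k"
    unfolding eventually_spreading_filter by blast
  then have ev: "\<forall>\<^sub>F k in spreading_filter n. ?Z k \<le> 6 * (l2_norm a + l2_norm b)"
    "\<forall>\<^sub>F k in spreading_filter n. (l2_norm a + l2_norm b) / 7 \<le> ?Z k"
    by (auto elim: eventually_mono)
  show "q a b \<le> 6 * (l2_norm a + l2_norm b)"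
    by (rule tendsto_upperbound[OF lim ev(1) spreading_filter_nontrivial])
  have "(l2_norm a + l2_norm b) / 7 \<le> q a b"
    by (rule tendsto_lowerbound[OF lim ev(2) spreading_filter_nontrivial])
  then show "l2_norm a + l2_norm b \<le> 7 * q a b" by simp
qed


subsection \<open>The spreading model\<close>

lemma even_odd_c00:
  assumes "x \<in> c00"
  shows "(\<lambda>j. x (2 * j)) \<in> c00" "(\<lambda>j. x (Suc (2 * j))) \<in> c00"
  using finite_vimageI[of "{j. x j \<noteq> 0}" "\<lambda>j. 2 * j"]
    finite_vimageI[of "{j. x j \<noteq> 0}" "\<lambda>j. Suc (2 * j)"] assms
  by (auto simp: c00_def supp_def vimage_def inj_on_def)

text \<open>The sum of squares splits by parity. Finite supports turn the three series into finite
  sums, where the splitting is an induction on the length.\<close>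

lemma l2_norm_even_odd:
  assumes "x \<in> c00"
  shows "(l2_norm x)\<^sup>2 = (l2_norm (\<lambda>j. x (2 * j)))\<^sup>2 + (l2_norm (\<lambda>j. x (Suc (2 * j))))\<^sup>2"
proof -
  let ?f = "\<lambda>i. (cmod (x i))\<^sup>2"
  have sq: "(l2_norm y)\<^sup>2 = (\<Sum>j. (cmod (y j))\<^sup>2)" if "y \<in> c00" for y
    using that c00_subset_ell2 by (auto simp: l2_norm_def ell2_def intro!: suminf_nonneg)
  obtain N where N: "\<And>i. i \<ge> N \<Longrightarrow> x i = 0"
    using assms by (auto simp: c00_def supp_def finite_nat_set_iff_bounded) (metis leD)
  have "(\<Sum>i. ?f i) = (\<Sum>i<2*N. ?f i)"
    using N by (intro suminf_finite) auto
  moreover have "(\<Sum>i. ?f (2 * i)) = (\<Sum>i<N. ?f (2 * i))"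
    using N by (intro suminf_finite) auto
  moreover have "(\<Sum>i. ?f (Suc (2 * i))) = (\<Sum>i<N. ?f (Suc (2 * i)))"
    using N by (intro suminf_finite) auto
  moreover have "(\<Sum>i<2*M. ?f i) = (\<Sum>i<M. ?f (2 * i)) + (\<Sum>i<M. ?f (Suc (2 * i)))" for M
    by (induction M) auto
  ultimately show ?thesis
    using sq[OF assms] sq[OF even_odd_c00(1)[OF assms]] sq[OF even_odd_c00(2)[OF assms]] by simp
qed

lemma interleave_c00:
  assumes "a \<in> c00" "b \<in> c00"
  shows "(\<lambda>i. if even i then a (i div 2) else b (i div 2)) \<in> c00"
proof -
  let ?x = "\<lambda>i. if even i then a (i div 2) else b (i div 2)"
  have "i \<in> (\<lambda>j. 2 * j) ` supp a \<union> (\<lambda>j. Suc (2 * j)) ` supp b" if "?x i \<noteq> 0" for i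
    using that by (cases "even i") (auto simp: supp_def elim!: evenE oddE)
  then have "supp ?x \<subseteq> (\<lambda>j. 2 * j) ` supp a \<union> (\<lambda>j. Suc (2 * j)) ` supp b"
    unfolding supp_def[of ?x] by blast
  then show ?thesis using assms by (simp add: c00_def finite_subset)
qed

theorem theorem1:
  fixes B :: "(nat \<Rightarrow> complex) \<Rightarrow> complex \<Rightarrow> nat \<Rightarrow> complex"
    and smul :: "complex \<Rightarrow> 'y::ab_group_add \<Rightarrow> 'y"
    and qn :: "'y \<Rightarrow> real"
  assumes "lozanovskii_selection T2_norm B"
    and "twisted_spreading_model (centralizer B) smul qn"
  shows "isomorphic_to_ell2 smul qn"
proof -
  obtain u q where u: "normalized_blocks u" and q: "spreading_norm (centralizer B) u q"
    and c: "completion_c00_pair q smul qn"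
    using assms(2) by (auto simp: twisted_spreading_model_def)
  from c obtain \<iota> where qb: "quasi_banach smul qn"
    and add: "\<forall>a\<in>c00. \<forall>b\<in>c00. \<forall>a'\<in>c00. \<forall>b'\<in>c00.
        \<iota> (\<lambda>j. a j + a' j) (\<lambda>j. b j + b' j) = \<iota> a b + \<iota> a' b'"
    and scale: "\<forall>a\<in>c00. \<forall>b\<in>c00. \<forall>c. \<iota> (\<lambda>j. c * a j) (\<lambda>j. c * b j) = smul c (\<iota> a b)"
    and norm: "\<forall>a\<in>c00. \<forall>b\<in>c00. qn (\<iota> a b) = q a b"
    and dense: "\<forall>y. \<forall>e>0. \<exists>a\<in>c00. \<exists>b\<in>c00. qn (y - \<iota> a b) < e"
    unfolding completion_c00_pair_def by (elim conjE exE)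
  \<comment> \<open>Even coordinates carry \<open>a\<close> and odd ones carry \<open>b\<close>,
    which identifies \<open>c00\<close> with the pairs from \<open>c00\<close>.\<close>
  define S where "S x = \<iota> (\<lambda>j. x (2 * j)) (\<lambda>j. x (Suc (2 * j)))" for x
  show ?thesis
  \<comment> \<open>The norm of \<open>x\<close> is at most the sum of the norms of its two halves,
    each of which is at most the norm of \<open>x\<close>. So 7 yields \<open>1/7\<close>, and 6
    doubles to 12.\<close>
  proof (rule isomorphic_to_ell2_if_dense_image[where S = S and m = "1/7" and M = 12, OF qb])
    fix x y :: "nat \<Rightarrow> complex" and c :: complex
    assume x: "x \<in> c00"
    let ?a = "\<lambda>j. x (2 * j)" and ?b = "\<lambda>j. x (Suc (2 * j))"
    note ab = even_odd_c00[OF x]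
    show "S (\<lambda>i. x i + y i) = S x + S y" if "y \<in> c00"
      unfolding S_def by (rule add[rule_format, OF ab even_odd_c00[OF that]])
    show "S (\<lambda>i. c * x i) = smul c (S x)"
      unfolding S_def by (rule scale[rule_format, OF ab])
    have nn: "0 \<le> l2_norm ?a" "0 \<le> l2_norm ?b" "0 \<le> l2_norm x"
      using ab x c00_subset_ell2 by (auto intro!: l2_norm_nonneg)
    have qS: "qn (S x) = q ?a ?b" unfolding S_def by (rule norm[rule_format, OF ab])
    have "l2_norm x \<le> l2_norm ?a + l2_norm ?b"
      by (rule power2_le_imp_le) (use nn l2_norm_even_odd[OF x] in \<open>auto simp: power2_sum\<close>)
    then show "1/7 * l2_norm x \<le> qn (S x)"
      using spreading_norm_equivalent(2)[OF assms(1) u q ab] qS by simp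
    have "l2_norm ?a \<le> l2_norm x" "l2_norm ?b \<le> l2_norm x"
      by (rule power2_le_imp_le; use nn l2_norm_even_odd[OF x] in auto)+
    then show "qn (S x) \<le> 12 * l2_norm x"
      using spreading_norm_equivalent(1)[OF assms(1) u q ab] qS by simp
  next
    fix y and e :: real assume "e > 0"
    then obtain a b where ab: "a \<in> c00" "b \<in> c00" "qn (y - \<iota> a b) < e" using dense by blast
    \<comment> \<open>Interleaving inverts the splitting, so \<open>S\<close> has the same range as
      \<open>\<iota>\<close> on pairs from \<open>c00\<close>, and density carries over.\<close>
    have "S (\<lambda>i. if even i then a (i div 2) else b (i div 2)) = \<iota> a b"
      by (simp add: S_def)
    then show "\<exists>x\<in>c00. qn (y - S x) < e"
      using ab(3) interleave_c00[OF ab(1,2)] by metis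
  qed auto
qed

end
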